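(* Let $R$ be a UFD, and let $p$ be a prime in $R$. Put $R':=R[s,s'\, :\, ss'=p]$. The following hold: (1) Both $s$ and $s'$ are prime in $R'$, and they are not associate. (2) Any prime $q\in R$ that is not associate to $p$ remains prime in $R'$. (3) The units in $R'$ are exactly the units in $R$ (i.e., $U(R')=U(R)$). In particular, the associates of any $r\in R$ are the same in both $R$ and $R'$. (4) The ring $R'$ is a UFD.
   Context: Rings are associative, commutative and unital. $U(A)$ denotes the group of units of a ring $A$. For an integral domain $R$ and $p\in R-\{0\}$, the notation $R[s,s'\, :\, ss'=p]$ denotes the ring $R[x,y]/(xy-p)$, where $x,y$ are algebraically independent polynomial indeterminates over $R$, with $s$ and $s'$ the images of $x$ and $y$; this is an integral domain and $R$ is identified with its (isomorphic) image in it. Equivalently, it is the subring $R[s,p/s]$ of the Laurent polynomial ring $R[s,s^{-1}]$, with $s'=p/s$. *)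

theory Defs
  imports "HOL-Algebra.UnivPoly" "HOL-Algebra.Ring_Divisibility"
begin

text \<open>
  \<open>R[x,y]\<close> is the iterated polynomial ring \<open>R[x][y]\<close>: the inner \<^const>\<open>UP\<close> has indeterminate
  \<open>x\<close>, the outer one has indeterminate \<open>y\<close>.
\<close>

abbreviation UP2 :: "('a, 'm) ring_scheme \<Rightarrow> (nat \<Rightarrow> 'a, nat \<Rightarrow> nat \<Rightarrow> 'a) up_ring"
  where "UP2 R \<equiv> UP (UP R)"

definition const2 :: "('a, 'm) ring_scheme \<Rightarrow> 'a \<Rightarrow> nat \<Rightarrow> nat \<Rightarrow> 'a"
  where "const2 R r = monom (UP2 R) (monom (UP R) r 0) 0"

definition var_x :: "('a, 'm) ring_scheme \<Rightarrow> nat \<Rightarrow> nat \<Rightarrow> 'a"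
  where "var_x R = monom (UP2 R) (monom (UP R) \<one>\<^bsub>R\<^esub> 1) 0"

definition var_y :: "('a, 'm) ring_scheme \<Rightarrow> nat \<Rightarrow> nat \<Rightarrow> 'a"
  where "var_y R = monom (UP2 R) \<one>\<^bsub>UP R\<^esub> 1"

definition xy_ideal :: "('a, 'm) ring_scheme \<Rightarrow> 'a \<Rightarrow> (nat \<Rightarrow> nat \<Rightarrow> 'a) set"
  where "xy_ideal R p =
    PIdl\<^bsub>UP2 R\<^esub> (var_x R \<otimes>\<^bsub>UP2 R\<^esub> var_y R \<ominus>\<^bsub>UP2 R\<^esub> const2 R p)"

text \<open>The ring \<open>R[s,s' : ss' = p] = R[x,y]/(xy - p)\<close>.\<close>

definition adj_ring :: "('a, 'm) ring_scheme \<Rightarrow> 'a \<Rightarrow> (nat \<Rightarrow> nat \<Rightarrow> 'a) set ring"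
  where "adj_ring R p = UP2 R Quot xy_ideal R p"

definition adj_s :: "('a, 'm) ring_scheme \<Rightarrow> 'a \<Rightarrow> (nat \<Rightarrow> nat \<Rightarrow> 'a) set"
  where "adj_s R p = xy_ideal R p +>\<^bsub>UP2 R\<^esub> var_x R"

definition adj_s' :: "('a, 'm) ring_scheme \<Rightarrow> 'a \<Rightarrow> (nat \<Rightarrow> nat \<Rightarrow> 'a) set"
  where "adj_s' R p = xy_ideal R p +>\<^bsub>UP2 R\<^esub> var_y R"

text \<open>
  The canonical map \<open>R \<rightarrow> R[s,s' : ss' = p]\<close>, along which \<open>R\<close> is identified with its image. That
  it is an injective ring homomorphism is shown below.
\<close>

definition adj_emb :: "('a, 'm) ring_scheme \<Rightarrow> 'a \<Rightarrow> 'a \<Rightarrow> (nat \<Rightarrow> nat \<Rightarrow> 'a) set"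
  where "adj_emb R p r = xy_ideal R p +>\<^bsub>UP2 R\<^esub> const2 R r"

context "domain"
begin

lemma UP2_domain: "domain (UP R)" "domain (UP2 R)"
proof -
  interpret P: UP_domain R "UP R" by unfold_locales
  show *: "domain (UP R)" by (rule P.UP_domain)
  then interpret PP: UP_domain "UP R" "UP2 R"
    by (simp add: UP_domain_def)
  show "domain (UP2 R)" by (rule PP.UP_domain)
qed

lemma var_closed:
  "var_x R \<in> carrier (UP2 R)" "var_y R \<in> carrier (UP2 R)"
  "r \<in> carrier R \<Longrightarrow> const2 R r \<in> carrier (UP2 R)"
proof -
  interpret P: UP_domain R "UP R" by unfold_locales
  interpret PP: UP_domain "UP R" "UP2 R"
    using UP2_domain by (simp add: UP_domain_def)
  show "var_x R \<in> carrier (UP2 R)" "var_y R \<in> carrier (UP2 R)"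
    "r \<in> carrier R \<Longrightarrow> const2 R r \<in> carrier (UP2 R)"
    by (simp_all add: var_x_def var_y_def const2_def)
qed

lemma const2_hom: "const2 R \<in> ring_hom R (UP2 R)"
proof -
  interpret P: UP_domain R "UP R" by unfold_locales
  interpret PP: UP_domain "UP R" "UP2 R"
    using UP2_domain by (simp add: UP_domain_def)
  show ?thesis
  proof (rule ring_hom_memI)
    fix a b assume ab: "a \<in> carrier R" "b \<in> carrier R"
    show "const2 R (a \<otimes> b) = const2 R a \<otimes>\<^bsub>UP2 R\<^esub> const2 R b"
      using ab P.monom_mult[of a b 0 0]
        PP.monom_mult[of "monom (UP R) a 0" "monom (UP R) b 0" 0 0]
      by (simp add: const2_def)
  qed (simp_all add: const2_def)
qed

context
  fixes p assumes p: "p \<in> carrier R"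
begin

lemma xy_ideal: "ideal (xy_ideal R p) (UP2 R)"
proof -
  interpret D: "domain" "UP2 R" by (rule UP2_domain)
  show ?thesis
    unfolding xy_ideal_def using p by (intro D.cgenideal_ideal) (simp add: var_closed)
qed

lemma adj_ring_cring: "cring (adj_ring R p)"
  unfolding adj_ring_def
  using ideal.quotient_is_cring[OF xy_ideal] UP2_domain(2) by (simp add: domain_def)

lemma adj_closed: "adj_s R p \<in> carrier (adj_ring R p)" "adj_s' R p \<in> carrier (adj_ring R p)"
  unfolding adj_ring_def adj_s_def adj_s'_def
  using ring_hom_closed[OF ideal.rcos_ring_hom[OF xy_ideal]] var_closed by blast+

lemma adj_emb_hom: "adj_emb R p \<in> ring_hom R (adj_ring R p)"
proof -
  have "(\<lambda>r. (xy_ideal R p +>\<^bsub>UP2 R\<^esub> const2 R r)) \<in> ring_hom R (adj_ring R p)"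
    using ring_hom_trans[OF const2_hom ideal.rcos_ring_hom[OF xy_ideal]]
    by (simp add: comp_def adj_ring_def)
  then show ?thesis
    by (simp add: adj_emb_def[abs_def])
qed

lemma adj_s_mult_adj_s': "adj_s R p \<otimes>\<^bsub>adj_ring R p\<^esub> adj_s' R p = adj_emb R p p"
proof -
  interpret D: "domain" "UP2 R" by (rule UP2_domain)
  interpret I: ideal "xy_ideal R p" "UP2 R" by (rule xy_ideal)
  let ?z = "var_x R \<otimes>\<^bsub>UP2 R\<^esub> var_y R"
  have "?z \<ominus>\<^bsub>UP2 R\<^esub> const2 R p \<in> xy_ideal R p"
    unfolding xy_ideal_def using p by (intro D.cgenideal_self) (simp add: var_closed)
  then have "xy_ideal R p +>\<^bsub>UP2 R\<^esub> ?z = xy_ideal R p +>\<^bsub>UP2 R\<^esub> const2 R p"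
    using p var_closed D.m_closed
      D.quotient_eq_iff_same_a_r_cos[OF xy_ideal, of ?z "const2 R p"] by blast
  moreover have "adj_s R p \<otimes>\<^bsub>adj_ring R p\<^esub> adj_s' R p = xy_ideal R p +>\<^bsub>UP2 R\<^esub> ?z"
    unfolding adj_ring_def adj_s_def adj_s'_def
    using ring_hom_mult[OF I.rcos_ring_hom var_closed(1,2)] by simp
  ultimately show ?thesis by (simp add: adj_emb_def)
qed

lemma adj_emb_inj: "inj_on (adj_emb R p) (carrier R)"
proof -
  interpret P: UP_domain R "UP R" by unfold_locales
  interpret PP: UP_domain "UP R" "UP2 R"
    using UP2_domain by (simp add: UP_domain_def)
  interpret I: ideal "xy_ideal R p" "UP2 R" by (rule xy_ideal)
  interpret Q: cring "adj_ring R p" by (rule adj_ring_cring)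
  interpret h: ring_hom_ring R "adj_ring R p" "adj_emb R p"
    by (rule ring_hom_ringI2[OF ring_axioms Q.ring_axioms adj_emb_hom])
  let ?x = "monom (UP R) \<one> 1"
  let ?g = "var_x R \<otimes>\<^bsub>UP2 R\<^esub> var_y R \<ominus>\<^bsub>UP2 R\<^esub> const2 R p"
  have x: "?x \<in> carrier (UP R)" by simp
  have "coeff (UP R) ?x 1 = \<one>" by (rule trans[OF P.coeff_monom]) simp_all
  then have x0: "?x \<noteq> \<zero>\<^bsub>UP R\<^esub>"
    using P.coeff_zero[of 1] one_not_zero by metis
  have gc: "?g \<in> carrier (UP2 R)"
    using p by (simp add: var_closed)
  have "?g = monom (UP2 R) ?x 1 \<ominus>\<^bsub>UP2 R\<^esub> const2 R p"
    using x PP.monom_mult[of ?x "\<one>\<^bsub>UP R\<^esub>" 0 1] by (simp add: var_x_def var_y_def)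
  then have "coeff (UP2 R) ?g 1 = ?x"
    using x p by (simp add: const2_def a_minus_def)
  with x0 have c: "coeff (UP2 R) ?g 1 \<noteq> \<zero>\<^bsub>UP R\<^esub>" by metis
  then have g0: "?g \<noteq> \<zero>\<^bsub>UP2 R\<^esub>"
    using PP.coeff_zero[of 1] by metis
  have gdeg: "1 \<le> deg (UP R) ?g"
    using c gc by (intro PP.deg_belowI) blast+
  have "r = \<zero>" if r: "r \<in> carrier R" and e: "adj_emb R p r = \<zero>\<^bsub>adj_ring R p\<^esub>" for r
  proof -
    have "xy_ideal R p +>\<^bsub>UP2 R\<^esub> const2 R r = xy_ideal R p"
      using e by (simp add: adj_emb_def adj_ring_def FactRing_def)
    then have "const2 R r \<in> xy_ideal R p"
      using I.a_rcos_self r var_closed(3) by blast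
    then obtain f where f: "f \<in> carrier (UP2 R)" "const2 R r = f \<otimes>\<^bsub>UP2 R\<^esub> ?g"
      unfolding xy_ideal_def cgenideal_def by blast
    have "f = \<zero>\<^bsub>UP2 R\<^esub>"
    proof (rule ccontr)
      assume "f \<noteq> \<zero>\<^bsub>UP2 R\<^esub>"
      then have "deg (UP R) (const2 R r) = deg (UP R) f + deg (UP R) ?g"
        using f g0 gc PP.deg_mult by simp
      then show False using gdeg r by (simp add: const2_def)
    qed
    then have "const2 R r = \<zero>\<^bsub>UP2 R\<^esub>" using f gc by simp
    then have "coeff (UP2 R) (const2 R r) 0 = \<zero>\<^bsub>UP R\<^esub>" by simp
    then have "monom (UP R) r 0 = \<zero>\<^bsub>UP R\<^esub>" using r by (simp add: const2_def)
    then have "coeff (UP R) (monom (UP R) r 0) 0 = \<zero>" using P.coeff_zero by metis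
    then show "r = \<zero>" using r by simp
  qed
  then have "a_kernel R (adj_ring R p) (adj_emb R p) = {\<zero>}"
    unfolding a_kernel_def' using h.hom_zero zero_closed by blast
  then show ?thesis by (rule h.trivial_ker_imp_inj)
qed

end

end

end

(*
  As an R-module, R' is free on the monomials u n, where u n is s^n for n >= 0 and t^(-n) for n < 0
  (t = s' = p/s), and u m * u n is a power of p times u (m + n).  Comparing extreme coefficients,
  homogeneous ideals can be tested for primality on homogeneous elements; this gives that R' is a
  domain and that s, t and every prime q of R not associated with p are prime in R'.  Hence every
  nonzero homogeneous element is a product of primes.  Cancelling leading terms by multiplying with
  such elements is a pseudo-division that decreases the width of the support, and as in Nagata's
  theorem this suffices for irreducible elements to be prime.  Chains of divisors are controlled by
  an additive weight: count the prime factors of the highest and of the lowest coefficient twice and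
  add the absolute values of their degrees.  Only the units of R have weight 0.
*)

theory Submission
  imports Defs
begin

section \<open>Products of primes and unique factorization\<close>

text \<open>Behind the argument stands a localization that is never built: inverting all nonzero
  homogeneous elements of R' gives K[s, 1/s], with K the fraction field of R, and this ring is
  Euclidean for the width of the support. Pseudo-division is its division with remainder after
  clearing denominators. The denominators may be cleared because they are products of primes of R':
  a prime of R not associated with p stays prime, p splits as s t, and every u n is a power of s or
  of t. The difference from Laurent polynomials is the rule u m * u n = p^e u (m + n). The weight
  has to absorb p^e, and the identity 2 e + |m + n| = |m| + |n| dictates the factor 2. The
  coordinates with respect to the u n are axiomatized in the locale \<open>adjunction\<close>. Thus
  exchanging s and t is just another instance of the locale, and the quotient by xy - p matters only
  for producing the coordinates.\<close>

inductive_set prime_products :: "('a, 'm) ring_scheme \<Rightarrow> 'a set" for R (structure) where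
  unit: "u \<in> Units R \<Longrightarrow> u \<in> prime_products R"
| mult: "\<lbrakk>q \<in> carrier R; ring_prime q; c \<in> prime_products R\<rbrakk> \<Longrightarrow> q \<otimes> c \<in> prime_products R"

context "domain"
begin

lemma prime_products_closed: "c \<in> prime_products R \<Longrightarrow> c \<in> carrier R - {\<zero>}"
proof (induction rule: prime_products.induct)
  case (unit u)
  then show ?case using Units_closed Units_r_inv[of u] one_not_zero by (metis DiffI Units_inv_closed l_null singletonD)
next
  case (mult q c)
  then show ?case by (auto simp: integral_iff ring_prime_def)
qed

lemma prime_products_mult:
  assumes "c \<in> prime_products R" "d \<in> prime_products R"
  shows "c \<otimes> d \<in> prime_products R"
  using assms(1)
proof (induction rule: prime_products.induct)
  case (unit u)
  note u = this
  show ?case using assms(2)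
  proof (induction rule: prime_products.induct)
    case (unit v)
    then show ?case using u by (simp add: prime_products.unit)
  next
    case (mult q c)
    have "u \<otimes> (q \<otimes> c) = q \<otimes> (u \<otimes> c)"
      using u mult prime_products_closed[OF mult(3)] by (simp add: Units_closed m_lcomm)
    then show ?case using mult by (simp add: prime_products.mult)
  qed
next
  case (mult q c)
  then show ?case
    using prime_products_closed[OF mult(3)] prime_products_closed[OF assms(2)]
    by (simp add: m_assoc prime_products.mult)
qed

lemma prime_in_prime_products:
  assumes "q \<in> carrier R" "ring_prime q" shows "q \<in> prime_products R"
  using prime_products.mult[OF assms prime_products.unit[OF Units_one_closed]] assms by simp

lemma prime_products_pow:
  assumes "c \<in> prime_products R" shows "c [^] (n::nat) \<in> prime_products R"
  by (induction n) (auto intro: prime_products.unit prime_products_mult assms)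

lemma ring_prime_divides_mult:
  assumes "ring_prime q" "a \<in> carrier R" "b \<in> carrier R" "q divides a \<otimes> b"
  shows "q divides a \<or> q divides b"
  using assms unfolding ring_prime_def by (meson primeE)

text \<open>A factorization of f after inverting primes comes from one of f itself. Every prime in c
  divides q or d and can be cancelled there; the primes taken from d are collected in c'.\<close>

lemma prime_product_cancel:
  assumes "c \<in> prime_products R" "f \<in> carrier R" "q \<in> carrier R" "d \<in> carrier R"
    and "c \<otimes> f = q \<otimes> d"
  shows "\<exists>q' d' c'. q' \<in> carrier R \<and> d' \<in> carrier R \<and> c' \<in> prime_products R \<and>
    f = q' \<otimes> d' \<and> d = d' \<otimes> c'"
  using assms
proof (induction arbitrary: q d rule: prime_products.induct)
  case (unit u)
  have "f = inv u \<otimes> (u \<otimes> f)"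
    using unit(1,2) by (simp add: m_assoc[symmetric] Units_closed)
  also have "\<dots> = (inv u \<otimes> q) \<otimes> d" using unit by (simp add: m_assoc)
  finally show ?case
    using unit by (intro exI[of _ "inv u \<otimes> q"] exI[of _ d] exI[of _ \<one>])
      (auto intro: prime_products.unit)
next
  case (mult \<pi> c)
  have c: "c \<in> carrier R" using prime_products_closed mult by blast
  have \<pi>0: "\<pi> \<noteq> \<zero>" using mult by (simp add: ring_prime_def)
  have "\<pi> divides q \<otimes> d"
    using mult c by (intro dividesI[of "c \<otimes> f"]) (simp_all add: m_assoc[symmetric])
  then consider "\<pi> divides q" | "\<pi> divides d"
    using ring_prime_divides_mult mult by blast
  then show ?case
  proof cases
    case 1
    then obtain q' where q': "q' \<in> carrier R" "q = \<pi> \<otimes> q'" by blast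
    have "\<pi> \<otimes> (c \<otimes> f) = \<pi> \<otimes> (q' \<otimes> d)" using mult q' c by (simp add: m_assoc)
    then have "c \<otimes> f = q' \<otimes> d" using \<pi>0 mult q' c by (simp add: m_lcancel)
    then show ?thesis using mult q' by blast
  next
    case 2
    then obtain d' where d': "d' \<in> carrier R" "d = \<pi> \<otimes> d'" by blast
    have "\<pi> \<otimes> (c \<otimes> f) = \<pi> \<otimes> (q \<otimes> d')" using mult d' c by (simp add: m_assoc m_lcomm)
    then have "c \<otimes> f = q \<otimes> d'" using \<pi>0 mult d' c by (simp add: m_lcancel)
    then obtain q1 d1 e where *: "q1 \<in> carrier R" "d1 \<in> carrier R" "e \<in> prime_products R"
      "f = q1 \<otimes> d1" "d' = d1 \<otimes> e"
      using mult.IH[of q d'] mult.prems d' by blast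
    have "d = d1 \<otimes> (\<pi> \<otimes> e)"
      using * d' mult prime_products_closed[OF *(3)] by (simp add: m_lcomm)
    then show ?thesis using * mult prime_products.mult[of \<pi> R e] by blast
  qed
qed

text \<open>A prime of c does not divide f, so it divides the cofactor of f in c g and can be
  cancelled on both sides.\<close>

lemma divides_prime_product_mult:
  assumes "c \<in> prime_products R" "f \<in> carrier R" "g \<in> carrier R"
    and "\<And>q. \<lbrakk>q \<in> carrier R; ring_prime q\<rbrakk> \<Longrightarrow> \<not> q divides f"
    and "f divides c \<otimes> g"
  shows "f divides g"
  using assms
proof (induction arbitrary: g rule: prime_products.induct)
  case (unit u)
  then obtain h where h: "h \<in> carrier R" "u \<otimes> g = f \<otimes> h" by blast
  have "g = inv u \<otimes> (u \<otimes> g)"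
    using unit(1,3) by (simp add: m_assoc[symmetric] Units_closed)
  also have "\<dots> = f \<otimes> (inv u \<otimes> h)" using unit h by (simp add: m_lcomm)
  finally show ?case using unit h by (intro dividesI[of "inv u \<otimes> h"]) auto
next
  case (mult \<pi> c)
  have c: "c \<in> carrier R" using prime_products_closed mult by blast
  have \<pi>0: "\<pi> \<noteq> \<zero>" using mult by (simp add: ring_prime_def)
  from mult.prems obtain h where h: "h \<in> carrier R" "\<pi> \<otimes> c \<otimes> g = f \<otimes> h" by blast
  have "\<pi> divides f \<otimes> h"
    using mult c h by (intro dividesI[of "c \<otimes> g"]) (simp_all add: m_assoc[symmetric])
  then have "\<pi> divides h" using ring_prime_divides_mult mult h by blast
  then obtain h' where h': "h' \<in> carrier R" "h = \<pi> \<otimes> h'" by blast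
  have "\<pi> \<otimes> (c \<otimes> g) = f \<otimes> (\<pi> \<otimes> h')"
    using h(2) mult.hyps mult.prems(2) c unfolding h'(2) by (simp add: m_assoc)
  also have "\<dots> = \<pi> \<otimes> (f \<otimes> h')" using mult.hyps mult.prems(1) h' by (intro m_lcomm) auto
  finally have "\<pi> \<otimes> (c \<otimes> g) = \<pi> \<otimes> (f \<otimes> h')" .
  then have "c \<otimes> g = f \<otimes> h'"
    using \<pi>0 mult.hyps mult.prems(1,2) h' c by (simp add: m_lcancel)
  then have "f divides c \<otimes> g" using h' by blast
  then show ?case using mult.IH mult.prems(1-3) by blast
qed

text \<open>If some prime divides f, then f is associated with it. Otherwise divisibility by f is
  insensitive to prime products, and the usual Bezout argument works with "up to a prime product" in
  place of equality.\<close>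

lemma irreducible_imp_prime_of_pseudo_division:
  fixes \<phi> :: "'a \<Rightarrow> nat"
  assumes pseudo_division: "\<And>f d. \<lbrakk>f \<in> carrier R - {\<zero>}; d \<in> carrier R - {\<zero>}\<rbrakk> \<Longrightarrow>
      \<exists>c q r. c \<in> prime_products R \<and> q \<in> carrier R \<and> r \<in> carrier R \<and>
        c \<otimes> f = q \<otimes> d \<oplus> r \<and> (r = \<zero> \<or> \<phi> r < \<phi> d)"
    and f: "f \<in> carrier R" "ring_irreducible f"
  shows "ring_prime f"
proof (cases "\<exists>q. q \<in> carrier R \<and> ring_prime q \<and> q divides f")
  case True
  then obtain q a where q: "q \<in> carrier R" "ring_prime q" "a \<in> carrier R" "f = q \<otimes> a" by blast
  then have "q \<notin> Units R" by (simp add: ring_prime_def prime_def)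
  then have "a \<in> Units R" using ring_irreducibleE(5)[OF f q(1,3,4)] by blast
  then have "q \<sim>\<^bsub>mult_of R\<^esub> f"
    using ring_associated_iff[of f q] q f associated_sym m_comm Units_closed assoc_iff_assoc_mult
    by metis
  then have "prime (mult_of R) f"
    using mult_of.prime_cong[of q f] q f ring_primeE[of q] ring_irreducibleE(1)[OF f] by simp
  then show ?thesis using f ring_irreducibleE(1)[OF f] by (intro ring_primeI') auto
next
  case False
  have f0: "f \<noteq> \<zero>" "f \<notin> Units R" using ring_irreducibleE[OF f] by auto
  have "f divides g \<or> f divides h"
    if gh: "g \<in> carrier R" "h \<in> carrier R" "f divides g \<otimes> h" for g h
  proof (rule disjCI)
    assume nh: "\<not> f divides h"
    show "f divides g"
    proof (cases "g = \<zero>")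
      case True
      then show ?thesis using f divides_zero by simp
    next
      case g0: False
      \<comment> \<open>This is the ideal generated by f and g without zero; an element d of least
        size plays the role of their greatest common divisor.\<close>
      define I where "I = {d. d \<noteq> \<zero> \<and> (\<exists>\<alpha> \<beta>. \<alpha> \<in> carrier R \<and> \<beta> \<in> carrier R \<and> d = \<alpha> \<otimes> f \<oplus> \<beta> \<otimes> g)}"
      have "f = \<one> \<otimes> f \<oplus> \<zero> \<otimes> g" "g = \<zero> \<otimes> f \<oplus> \<one> \<otimes> g" using f gh by auto
      then have fI: "f \<in> I" and gI: "g \<in> I"
        unfolding I_def using f0 g0 zero_closed one_closed by blast+
      obtain d where d: "d \<in> I" "\<And>d'. d' \<in> I \<Longrightarrow> \<phi> d \<le> \<phi> d'"
        using ex_has_least_nat[of "\<lambda>d. d \<in> I" f \<phi>] fI by blast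
      then obtain \<alpha> \<beta> where ab: "\<alpha> \<in> carrier R" "\<beta> \<in> carrier R" "d = \<alpha> \<otimes> f \<oplus> \<beta> \<otimes> g" "d \<noteq> \<zero>"
        unfolding I_def by blast
      have dc: "d \<in> carrier R" using ab f gh by simp
      \<comment> \<open>A nonzero remainder would again be a combination of f and g, smaller than
        d.\<close>
      have multiple: "\<exists>c q. c \<in> prime_products R \<and> q \<in> carrier R \<and> c \<otimes> x = q \<otimes> d" if x: "x \<in> I" for x
      proof -
        from x obtain a b where x': "a \<in> carrier R" "b \<in> carrier R" "x = a \<otimes> f \<oplus> b \<otimes> g" "x \<noteq> \<zero>"
          unfolding I_def by blast
        obtain c q r where c: "c \<in> prime_products R" "q \<in> carrier R" "r \<in> carrier R"
            "c \<otimes> x = q \<otimes> d \<oplus> r" "r = \<zero> \<or> \<phi> r < \<phi> d"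
          using pseudo_division[of x d] x' f gh dc ab(4) by auto
        have cc: "c \<in> carrier R" using prime_products_closed[OF c(1)] by simp
        have "q \<otimes> d \<in> carrier R" using c dc by simp
        then have "r = c \<otimes> x \<ominus> q \<otimes> d" unfolding c(4) using c(3) by algebra
        also have "\<dots> = (c \<otimes> a \<ominus> q \<otimes> \<alpha>) \<otimes> f \<oplus> (c \<otimes> b \<ominus> q \<otimes> \<beta>) \<otimes> g"
          unfolding x'(3) ab(3) using c(2) cc x'(1,2) ab(1,2) f(1) gh(1)
          by (simp add: a_minus_def l_distr r_distr l_minus minus_add m_assoc a_ac)
        finally have "r \<in> I" if "r \<noteq> \<zero>"
          unfolding I_def using that c(2) cc x'(1,2) ab(1,2)
          by (intro CollectI conjI exI[of _ "c \<otimes> a \<ominus> q \<otimes> \<alpha>"] exI[of _ "c \<otimes> b \<ominus> q \<otimes> \<beta>"]) simp_all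
        with c(5) d(2)[of r] have "r = \<zero>" by fastforce
        then show ?thesis using c dc by auto
      qed
      obtain c q where cq: "c \<in> prime_products R" "q \<in> carrier R" "c \<otimes> f = q \<otimes> d"
        using multiple[OF fI] by blast
      obtain c' q' where cq': "c' \<in> prime_products R" "q' \<in> carrier R" "c' \<otimes> g = q' \<otimes> d"
        using multiple[OF gI] by blast
      obtain q1 d1 e where *: "q1 \<in> carrier R" "d1 \<in> carrier R" "e \<in> prime_products R"
          "f = q1 \<otimes> d1" "d = d1 \<otimes> e"
        using prime_product_cancel[OF cq(1) f(1) cq(2) dc cq(3)] by blast
      have ec: "e \<in> carrier R" using prime_products_closed[OF *(3)] by simp
      \<comment> \<open>If q1 is a unit, then d is a multiple of f, hence so is c' g. If d1 is a
        unit, then d is a prime product, and f divides d h because it divides f h and g h.\<close>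
      have "q1 \<in> Units R \<or> d1 \<in> Units R" using ring_irreducibleE(5)[OF f *(1,2,4)] .
      then show ?thesis
      proof
        assume u: "q1 \<in> Units R"
        have "d1 = inv q1 \<otimes> f" using * u by (simp add: m_assoc[symmetric] Units_closed)
        then have "c' \<otimes> g = f \<otimes> (q' \<otimes> inv q1 \<otimes> e)"
          unfolding cq'(3) *(5) using * u cq' ec f Units_inv_closed[OF u] by (simp add: m_ac)
        then have "f divides c' \<otimes> g" using u cq' ec by (intro dividesI) auto
        then show ?thesis using divides_prime_product_mult[OF cq'(1) f(1) gh(1)] False by blast
      next
        assume u: "d1 \<in> Units R"
        obtain k where k: "k \<in> carrier R" "g \<otimes> h = f \<otimes> k" using gh by blast
        have "d \<otimes> h = \<alpha> \<otimes> f \<otimes> h \<oplus> \<beta> \<otimes> (g \<otimes> h)" unfolding ab(3) using ab(1,2) f(1) gh(1,2) by algebra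
        also have "\<dots> = f \<otimes> (\<alpha> \<otimes> h \<oplus> \<beta> \<otimes> k)" unfolding k(2) using ab(1,2) f(1) gh(2) k(1) by algebra
        finally have dh: "d \<otimes> h = f \<otimes> (\<alpha> \<otimes> h \<oplus> \<beta> \<otimes> k)" .
        have "(d1 \<otimes> e) \<in> prime_products R" using prime_products.unit[OF u] * prime_products_mult by blast
        then have "f divides h"
          using divides_prime_product_mult[of "d1 \<otimes> e" f h] f gh False dh ab k *(5)
          by (metis dividesI m_closed a_closed)
        then show ?thesis using nh by blast
      qed
    qed
  qed
  then have "prime R f" using f0 by (intro primeI) auto
  then show ?thesis using f0 by (intro ring_primeI)
qed

text \<open>
  A variant of Nagata's criterion: inverting the prime elements turns the pseudo-division into a
  Euclidean division.
\<close>

lemma factorial_domain_of_pseudo_division: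
  fixes \<phi> N :: "'a \<Rightarrow> nat"
  assumes pseudo_division: "\<And>f d. \<lbrakk>f \<in> carrier R - {\<zero>}; d \<in> carrier R - {\<zero>}\<rbrakk> \<Longrightarrow>
      \<exists>c q r. c \<in> prime_products R \<and> q \<in> carrier R \<and> r \<in> carrier R \<and>
        c \<otimes> f = q \<otimes> d \<oplus> r \<and> (r = \<zero> \<or> \<phi> r < \<phi> d)"
    and N_mult: "\<And>f g. \<lbrakk>f \<in> carrier R - {\<zero>}; g \<in> carrier R - {\<zero>}\<rbrakk> \<Longrightarrow> N (f \<otimes> g) = N f + N g"
    and N_unit: "\<And>f. \<lbrakk>f \<in> carrier R - {\<zero>}; N f = 0\<rbrakk> \<Longrightarrow> f \<in> Units R"
  shows "factorial_domain R"
proof -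
  \<comment> \<open>The cofactor of a proper divisor is not a unit, so \<open>N_unit\<close> makes
    its \<open>N\<close> positive; this bounds chains of divisors.\<close>
  have less: "N x < N y"
    if xy: "x \<in> carrier R - {\<zero>}" "y \<in> carrier R - {\<zero>}" "properfactor (mult_of R) x y" for x y
  proof -
    obtain z where z: "z \<in> carrier R - {\<zero>}" "y = x \<otimes> z"
      using xy unfolding properfactor_def factor_def by auto
    have "z \<notin> Units R"
    proof
      assume u: "z \<in> Units R"
      then have "x = y \<otimes> inv z" using xy z by (simp add: m_assoc Units_closed)
      moreover have "inv z \<in> carrier R - {\<zero>}"
        using u prime_products_closed[OF prime_products.unit[of "inv z"]] by simp
      ultimately have "y divides\<^bsub>mult_of R\<^esub> x" unfolding factor_def by auto
      then show False using xy unfolding properfactor_def by simp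
    qed
    then have "N z \<noteq> 0" using N_unit z by blast
    then show ?thesis using N_mult xy z by simp
  qed
  have "divisor_chain_condition_monoid (mult_of R)"
  proof
    show "wf {(x, y). x \<in> carrier (mult_of R) \<and> y \<in> carrier (mult_of R) \<and> properfactor (mult_of R) x y}"
      by (rule wf_subset[OF wf_measure[of N]]) (auto simp: less)
  qed
  moreover have "primeness_condition_monoid (mult_of R)"
  proof
    fix a assume a: "a \<in> carrier (mult_of R)" "irreducible (mult_of R) a"
    then have "ring_irreducible a" by (intro ring_irreducibleI') auto
    then have "ring_prime a"
      using irreducible_imp_prime_of_pseudo_division[OF pseudo_division] a by simp
    then show "prime (mult_of R) a" using ring_primeE a by simp
  qed
  ultimately have "factorial_monoid (mult_of R)"
    using factorial_condition_one by blast
  then show ?thesis by (intro factorial_domain.intro domain_axioms)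
qed

end

section \<open>Ideals of multiples, associated primes, and counting prime factors\<close>

lemma (in cring) multiples_ideal:
  assumes "a \<in> carrier R" shows "ideal {x \<in> carrier R. a divides x} R"
proof -
  have "PIdl a = {x \<in> carrier R. a divides x}"
    using assms by (auto simp: cgenideal_def factor_def m_comm)
  then show ?thesis using cgenideal_ideal[OF assms] by simp
qed

lemma (in cring) divides_add:
  assumes "a \<in> carrier R" "a divides x" "a divides y"
  shows "a divides (x \<oplus> y)"
proof -
  obtain b c where "b \<in> carrier R" "c \<in> carrier R" "x = a \<otimes> b" "y = a \<otimes> c"
    using assms(2,3) unfolding factor_def by blast
  then show ?thesis using assms(1) by (intro dividesI[of "b \<oplus> c"]) (simp_all add: r_distr)
qed

text \<open>Let p = q c. If p did not divide q, it would divide c, and cancelling p would make q a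
  unit.\<close>

lemma (in "domain") prime_divides_prime_imp_associated:
  assumes "p \<in> carrier R" "ring_prime p" "q \<in> carrier R" "ring_prime q" "q divides p"
  shows "q \<sim> p"
proof (rule associatedI[OF assms(5)])
  obtain c where c: "c \<in> carrier R" "p = q \<otimes> c" using assms(5) by blast
  show "p divides q"
  proof (rule ccontr)
    assume "\<not> p divides q"
    then have "p divides c"
      using ring_prime_divides_mult[of p q c] assms c divides_refl[of p] by metis
    then obtain d where d: "d \<in> carrier R" "c = p \<otimes> d" by blast
    have "p \<otimes> (q \<otimes> d) = q \<otimes> c" unfolding d(2) using d(1) assms(1,3) by (simp add: m_lcomm)
    then have "p \<otimes> (q \<otimes> d) = p \<otimes> \<one>" using c(2) assms(1) by simp
    then have "q \<otimes> d = \<one>"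
      using assms(1-3) d(1) m_lcancel[of p "q \<otimes> d" \<one>] by (simp add: ring_prime_def)
    then have "q divides \<one>" using d by (intro dividesI[of d]) auto
    then show False using assms(3,4) divides_one[of q] unfolding ring_prime_def prime_def by blast
  qed
qed

lemma (in factorial_domain) prime_products_eq: "prime_products R = carrier R - {\<zero>}"
proof (intro equalityI subsetI)
  fix a assume a: "a \<in> carrier R - {\<zero>}"
  then obtain as where as: "set as \<subseteq> carrier (mult_of R)" "wfactors (mult_of R) as a"
    using wfactors_exist[of a] by auto
  have "foldr (\<otimes>) as \<one> \<in> prime_products R"
    if "set as \<subseteq> carrier (mult_of R)" "\<forall>x\<in>set as. irreducible (mult_of R) x" for as
    using that
  proof (induction as)
    case Nil
    show ?case by (simp add: prime_products.unit)
  next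
    case (Cons x xs)
    then have "prime (mult_of R) x" by (intro irreducible_prime) auto
    then have "ring_prime x" using Cons.prems(1) by (intro ring_primeI') auto
    then show ?case using Cons by (simp add: prime_products.mult)
  qed
  then have "foldr (\<otimes>) as \<one> \<in> prime_products R" using as by (simp add: wfactors_def)
  \<comment> \<open>The factors determine a only up to a unit, which
    \<open>prime_products.unit\<close> absorbs.\<close>
  moreover have "foldr (\<otimes>) as \<one> \<sim>\<^bsub>mult_of R\<^esub> a" using as by (simp add: wfactors_def)
  ultimately have "a \<sim> foldr (\<otimes>) as \<one>" "foldr (\<otimes>) as \<one> \<in> carrier R" "foldr (\<otimes>) as \<one> \<in> prime_products R"
    using prime_products_closed assoc_iff_assoc_mult[of "foldr (\<otimes>) as \<one>" a] a associated_sym by auto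
  then obtain v where "v \<in> Units R" "a = v \<otimes> foldr (\<otimes>) as \<one>" "foldr (\<otimes>) as \<one> \<in> prime_products R"
    using ring_associated_iff[of a "foldr (\<otimes>) as \<one>"] a by auto
  then show "a \<in> prime_products R" by (simp add: prime_products_mult prime_products.unit)
qed (use prime_products_closed in blast)

lemma (in factorial_monoid) factorcount_mult:
  assumes "a \<in> carrier G" "b \<in> carrier G"
  shows "factorcount G (a \<otimes> b) = factorcount G a + factorcount G b"
proof -
  obtain as where as: "set as \<subseteq> carrier G" "wfactors G as a" using wfactors_exist assms by blast
  obtain bs where bs: "set bs \<subseteq> carrier G" "wfactors G bs b" using wfactors_exist assms by blast
  have "wfactors G (as @ bs) (a \<otimes> b)" using as bs assms by (intro wfactors_mult) auto
  then have "factorcount G (a \<otimes> b) = length (as @ bs)"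
    using as bs assms by (intro factorcount_unique) auto
  then show ?thesis using as bs assms by (simp add: factorcount_unique)
qed

lemma (in factorial_monoid) factorcount_eq_0_imp_Units:
  assumes "a \<in> carrier G" "factorcount G a = 0" shows "a \<in> Units G"
proof -
  obtain as where as: "set as \<subseteq> carrier G" "wfactors G as a" using wfactors_exist assms by blast
  then have "as = []" using assms factorcount_unique by fastforce
  then have "\<one> \<sim> a" using as by (simp add: wfactors_def)
  then have "a divides \<one>" by (simp add: associated_def)
  then show ?thesis using Unit_eq_dividesone[OF assms(1)] by simp
qed

lemma (in factorial_monoid) factorcount_Units:
  assumes "a \<in> Units G" shows "factorcount G a = 0"
  using factorcount_unique[OF unit_wfactors[OF assms]] Units_closed[OF assms] by simp

lemma (in factorial_monoid) factorcount_irreducible: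
  assumes "a \<in> carrier G" "irreducible G a" shows "factorcount G a = 1"
proof -
  have "wfactors G [a] a" using assms by (simp add: wfactors_def)
  from factorcount_unique[OF this] show ?thesis using assms by simp
qed

section \<open>The grading of \<open>R[s, t : st = p]\<close>\<close>

text \<open>The exponent of \<open>p = st\<close> in the product of the monomials \<open>u m\<close> and \<open>u n\<close> below.\<close>

definition xy_exp :: "int \<Rightarrow> int \<Rightarrow> nat" where
  "xy_exp m n = min (nat m + nat n) (nat (- m) + nat (- n))"

lemma xy_exp_0 [simp]: "xy_exp 0 n = 0"
  by (simp add: xy_exp_def)

lemma xy_exp_commute: "xy_exp m n = xy_exp n m"
  by (simp add: xy_exp_def add.commute)

lemma xy_exp_same_sign: "0 \<le> m \<and> 0 \<le> n \<or> m \<le> 0 \<and> n \<le> 0 \<Longrightarrow> xy_exp m n = 0"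
  by (auto simp: xy_exp_def)

text \<open>With a and b the sums of the positive and of the negative parts, this is 2 min(a, b) +
  |a - b| = a + b. It makes \<open>weight\<close> additive.\<close>

lemma two_xy_exp: "2 * xy_exp m n + nat \<bar>m + n\<bar> = nat \<bar>m\<bar> + nat \<bar>n\<bar>"
  by (auto simp: xy_exp_def min_def) arith+

text \<open>The part of the setting that follows from s t = p alone. It yields the multiplication
  table of the monomials u n, which is used on the quotient ring before coordinates exist
  there.\<close>

locale adjunction_generators = "domain" R + S: cring S for R (structure) and S (structure) +
  fixes emb :: "'a \<Rightarrow> 'c" and p :: 'a and s t :: 'c and u :: "int \<Rightarrow> 'c"
  defines "u n \<equiv> s [^]\<^bsub>S\<^esub> nat n \<otimes>\<^bsub>S\<^esub> t [^]\<^bsub>S\<^esub> nat (- n)"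
  assumes emb_hom: "emb \<in> ring_hom R S"
    and p_closed: "p \<in> carrier R" and p_nonzero: "p \<noteq> \<zero>"
    and s_closed: "s \<in> carrier S" and t_closed: "t \<in> carrier S"
    and s_mult_t: "s \<otimes>\<^bsub>S\<^esub> t = emb p"
begin

sublocale emb: ring_hom_cring R S emb
  by (rule UnivPoly.ring_hom_cringI[OF is_cring S.cring_axioms emb_hom])

declare emb.hom_mult [simp del] emb.hom_pow [simp del]

declare p_closed [simp] s_closed [simp] t_closed [simp] 

lemma p_pow_nonzero: "p [^] (k::nat) \<noteq> \<zero>"
  by (induction k) (auto simp: integral_iff p_nonzero)

lemma u_closed [simp]: "u n \<in> carrier S"
  by (simp add: u_def)

lemma u_0: "u 0 = \<one>\<^bsub>S\<^esub>" and u_1: "u 1 = s" and u_minus_1: "u (- 1) = t"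
  by (simp_all add: u_def)

lemma s_pow_mult_t_pow:
  "s [^]\<^bsub>S\<^esub> i \<otimes>\<^bsub>S\<^esub> t [^]\<^bsub>S\<^esub> j = emb (p [^] min i j) \<otimes>\<^bsub>S\<^esub> u (int i - int j)"
proof -
  have st: "s [^]\<^bsub>S\<^esub> k \<otimes>\<^bsub>S\<^esub> t [^]\<^bsub>S\<^esub> k = emb (p [^] k)" for k :: nat
    using S.nat_pow_distrib[of s t k] s_mult_t emb.hom_pow[of p k] by simp
  consider d where "i = j + d" | d where "j = i + d"
    by (metis le_add_diff_inverse nat_le_linear)
  then show ?thesis
  proof cases
    case 1
    have "s [^]\<^bsub>S\<^esub> (j + d) \<otimes>\<^bsub>S\<^esub> t [^]\<^bsub>S\<^esub> j = (s [^]\<^bsub>S\<^esub> j \<otimes>\<^bsub>S\<^esub> t [^]\<^bsub>S\<^esub> j) \<otimes>\<^bsub>S\<^esub> s [^]\<^bsub>S\<^esub> d"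
      by (simp add: S.nat_pow_mult[symmetric] S.m_ac)
    then show ?thesis using 1 by (simp add: st u_def)
  next
    case 2
    have "s [^]\<^bsub>S\<^esub> i \<otimes>\<^bsub>S\<^esub> t [^]\<^bsub>S\<^esub> (i + d) = (s [^]\<^bsub>S\<^esub> i \<otimes>\<^bsub>S\<^esub> t [^]\<^bsub>S\<^esub> i) \<otimes>\<^bsub>S\<^esub> t [^]\<^bsub>S\<^esub> d"
      by (simp add: S.nat_pow_mult[symmetric] S.m_ac)
    then show ?thesis using 2 by (simp add: st u_def)
  qed
qed

lemma u_mult: "u m \<otimes>\<^bsub>S\<^esub> u n = emb (p [^] xy_exp m n) \<otimes>\<^bsub>S\<^esub> u (m + n)"
proof -
  have "u m \<otimes>\<^bsub>S\<^esub> u n = s [^]\<^bsub>S\<^esub> (nat m + nat n) \<otimes>\<^bsub>S\<^esub> t [^]\<^bsub>S\<^esub> (nat (- m) + nat (- n))"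
    by (simp add: u_def S.nat_pow_mult[symmetric] S.m_ac)
  also have "\<dots> = emb (p [^] xy_exp m n) \<otimes>\<^bsub>S\<^esub> u (int (nat m + nat n) - int (nat (- m) + nat (- n)))"
    by (simp only: s_pow_mult_t_pow xy_exp_def)
  also have "int (nat m + nat n) - int (nat (- m) + nat (- n)) = m + n" by simp
  finally show ?thesis .
qed

lemma monom_mult_monom:
  assumes "a \<in> carrier R" "b \<in> carrier R"
  shows "(emb a \<otimes>\<^bsub>S\<^esub> u m) \<otimes>\<^bsub>S\<^esub> (emb b \<otimes>\<^bsub>S\<^esub> u n) =
    emb (a \<otimes> (b \<otimes> p [^] xy_exp m n)) \<otimes>\<^bsub>S\<^esub> u (m + n)"
proof -
  have "(emb a \<otimes>\<^bsub>S\<^esub> u m) \<otimes>\<^bsub>S\<^esub> (emb b \<otimes>\<^bsub>S\<^esub> u n) = (emb a \<otimes>\<^bsub>S\<^esub> emb b) \<otimes>\<^bsub>S\<^esub> (u m \<otimes>\<^bsub>S\<^esub> u n)"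
    using assms by (simp add: S.m_ac)
  then show ?thesis using assms by (simp add: u_mult S.m_assoc emb.hom_mult)
qed

end

text \<open>
  Coordinates on \<open>R[s, t : st = p]\<close>: as an \<open>R\<close>-module it is free on the \<open>u n\<close> for \<open>n :: int\<close>,
  and \<open>coef f n\<close> is the coordinate of \<open>f\<close> at \<open>u n\<close>.
\<close>

locale adjunction = adjunction_generators +
  fixes coef :: "'c \<Rightarrow> int \<Rightarrow> 'a"
  assumes coef_closed: "f \<in> carrier S \<Longrightarrow> coef f n \<in> carrier R"
    and coef_add: "\<lbrakk>f \<in> carrier S; g \<in> carrier S\<rbrakk> \<Longrightarrow> coef (f \<oplus>\<^bsub>S\<^esub> g) n = coef f n \<oplus> coef g n"
    and coef_monom: "a \<in> carrier R \<Longrightarrow> coef (emb a \<otimes>\<^bsub>S\<^esub> u m) n = (if n = m then a else \<zero>)"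
    and coef_eq_zero: "\<lbrakk>f \<in> carrier S; \<And>n. coef f n = \<zero>\<rbrakk> \<Longrightarrow> f = \<zero>\<^bsub>S\<^esub>"
    and monom_induct [consumes 1, case_names monom add]: "\<lbrakk>f \<in> carrier S; \<And>a n. a \<in> carrier R \<Longrightarrow> P (emb a \<otimes>\<^bsub>S\<^esub> u n);
      \<And>f g. \<lbrakk>f \<in> carrier S; g \<in> carrier S; P f; P g\<rbrakk> \<Longrightarrow> P (f \<oplus>\<^bsub>S\<^esub> g)\<rbrakk> \<Longrightarrow> P f"
begin

declare coef_closed [simp]

lemma coef_zero: "coef \<zero>\<^bsub>S\<^esub> n = \<zero>"
  using coef_monom[OF zero_closed, of 0 n] by (simp split: if_splits)

lemma coef_one: "coef \<one>\<^bsub>S\<^esub> n = (if n = 0 then \<one> else \<zero>)"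
  using coef_monom[OF one_closed, of 0 n] by (simp add: u_0)

lemma coef_minus:
  assumes "f \<in> carrier S" "g \<in> carrier S"
  shows "coef (f \<ominus>\<^bsub>S\<^esub> g) n = coef f n \<ominus> coef g n"
proof -
  have "f = (f \<ominus>\<^bsub>S\<^esub> g) \<oplus>\<^bsub>S\<^esub> g" using assms by algebra
  then have "coef f n = coef (f \<ominus>\<^bsub>S\<^esub> g) n \<oplus> coef g n"
    using assms coef_add[of "f \<ominus>\<^bsub>S\<^esub> g" g n] by simp
  moreover have "x = (x \<oplus> y) \<ominus> y" if "x \<in> carrier R" "y \<in> carrier R" for x y
    using that by algebra
  ultimately show ?thesis using assms by simp
qed

lemma eq_monomI:
  assumes "f \<in> carrier S" "\<And>k. k \<noteq> n \<Longrightarrow> coef f k = \<zero>"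
  shows "f = emb (coef f n) \<otimes>\<^bsub>S\<^esub> u n"
proof -
  have "f \<ominus>\<^bsub>S\<^esub> emb (coef f n) \<otimes>\<^bsub>S\<^esub> u n = \<zero>\<^bsub>S\<^esub>"
    using assms by (intro coef_eq_zero) (auto simp: coef_minus coef_monom)
  then show ?thesis using assms by simp
qed

section \<open>Coefficients of products\<close>

lemma coef_monom_mult:
  assumes "a \<in> carrier R" "f \<in> carrier S"
  shows "coef ((emb a \<otimes>\<^bsub>S\<^esub> u m) \<otimes>\<^bsub>S\<^esub> f) k =
    a \<otimes> (coef f (k - m) \<otimes> p [^] xy_exp m (k - m))"
  using assms(2)
proof (induction f rule: monom_induct)
  case (monom b n)
  then show ?case using assms(1) by (auto simp: monom_mult_monom coef_monom)
next
  case (add f g)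
  then show ?case using assms(1)
    by (simp add: S.r_distr coef_add l_distr r_distr)
qed

lemma finite_support: "f \<in> carrier S \<Longrightarrow> finite {n. coef f n \<noteq> \<zero>}"
proof (induction f rule: monom_induct)
  case (monom a n)
  then show ?case by - (rule finite_subset[of _ "{n}"], auto simp: coef_monom)
next
  case (add f g)
  then show ?case
    by - (rule finite_subset[of _ "{n. coef f n \<noteq> \<zero>} \<union> {n. coef g n \<noteq> \<zero>}"],
        auto simp: coef_add)
qed

text \<open>The natural index set is all of the integers, where \<open>finsum\<close> is not
  meaningful. Asking for every sufficiently large finite set instead lets the additive step of the
  induction simply unite the two sets A.\<close>

lemma coef_mult:
  assumes "f \<in> carrier S" "g \<in> carrier S"
  shows "\<exists>A. finite A \<and> (\<forall>B. finite B \<and> A \<subseteq> B \<longrightarrow>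
    coef (f \<otimes>\<^bsub>S\<^esub> g) k = (\<Oplus>i\<in>B. coef f i \<otimes> (coef g (k - i) \<otimes> p [^] xy_exp i (k - i))))"
  using assms(1)
proof (induction f rule: monom_induct)
  case (monom a n)
  let ?h = "\<lambda>i. a \<otimes> (coef g (k - i) \<otimes> p [^] xy_exp i (k - i))"
  have *: "coef ((emb a \<otimes>\<^bsub>S\<^esub> u n) \<otimes>\<^bsub>S\<^esub> g) k =
      (\<Oplus>i\<in>B. coef (emb a \<otimes>\<^bsub>S\<^esub> u n) i \<otimes> (coef g (k - i) \<otimes> p [^] xy_exp i (k - i)))"
    if "finite B" "n \<in> B" for B
  proof -
    have "(\<Oplus>i\<in>B. coef (emb a \<otimes>\<^bsub>S\<^esub> u n) i \<otimes> (coef g (k - i) \<otimes> p [^] xy_exp i (k - i))) =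
        (\<Oplus>i\<in>B. if n = i then ?h i else \<zero>)"
      using monom assms by (intro finsum_cong') (auto simp: coef_monom)
    also have "\<dots> = ?h n"
      using monom assms that by (intro finsum_singleton) auto
    finally show ?thesis using monom assms by (simp add: coef_monom_mult)
  qed
  show ?case
  proof (rule exI[of _ "{n}"], rule conjI, simp, intro allI impI)
    fix B assume "finite B \<and> {n} \<subseteq> B"
    then show "coef ((emb a \<otimes>\<^bsub>S\<^esub> u n) \<otimes>\<^bsub>S\<^esub> g) k =
      (\<Oplus>i\<in>B. coef (emb a \<otimes>\<^bsub>S\<^esub> u n) i \<otimes> (coef g (k - i) \<otimes> p [^] xy_exp i (k - i)))"
      by (intro *) auto
  qed
next
  case (add f1 f2)
  then obtain A1 A2 where A: "finite A1" "finite A2"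
    "\<And>B. finite B \<and> A1 \<subseteq> B \<Longrightarrow> coef (f1 \<otimes>\<^bsub>S\<^esub> g) k = (\<Oplus>i\<in>B. coef f1 i \<otimes> (coef g (k - i) \<otimes> p [^] xy_exp i (k - i)))"
    "\<And>B. finite B \<and> A2 \<subseteq> B \<Longrightarrow> coef (f2 \<otimes>\<^bsub>S\<^esub> g) k = (\<Oplus>i\<in>B. coef f2 i \<otimes> (coef g (k - i) \<otimes> p [^] xy_exp i (k - i)))"
    by blast
  have *: "coef ((f1 \<oplus>\<^bsub>S\<^esub> f2) \<otimes>\<^bsub>S\<^esub> g) k =
      (\<Oplus>i\<in>B. coef (f1 \<oplus>\<^bsub>S\<^esub> f2) i \<otimes> (coef g (k - i) \<otimes> p [^] xy_exp i (k - i)))"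
    if B: "finite B" "A1 \<union> A2 \<subseteq> B" for B
  proof -
    have "(\<Oplus>i\<in>B. coef (f1 \<oplus>\<^bsub>S\<^esub> f2) i \<otimes> (coef g (k - i) \<otimes> p [^] xy_exp i (k - i))) =
        (\<Oplus>i\<in>B. coef f1 i \<otimes> (coef g (k - i) \<otimes> p [^] xy_exp i (k - i))
          \<oplus> coef f2 i \<otimes> (coef g (k - i) \<otimes> p [^] xy_exp i (k - i)))"
      using add(1,2) assms by (intro finsum_cong') (auto simp: coef_add l_distr)
    also have "\<dots> = (\<Oplus>i\<in>B. coef f1 i \<otimes> (coef g (k - i) \<otimes> p [^] xy_exp i (k - i)))
        \<oplus> (\<Oplus>i\<in>B. coef f2 i \<otimes> (coef g (k - i) \<otimes> p [^] xy_exp i (k - i)))"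
      using add(1,2) assms by (intro finsum_addf) auto
    also have "\<dots> = coef (f1 \<otimes>\<^bsub>S\<^esub> g) k \<oplus> coef (f2 \<otimes>\<^bsub>S\<^esub> g) k"
      using A(3)[of B] A(4)[of B] B by simp
    finally show ?thesis using add(1,2) assms by (simp add: S.l_distr coef_add)
  qed
  show ?case
  proof (rule exI[of _ "A1 \<union> A2"], rule conjI, simp add: A(1,2), intro allI impI)
    fix B assume "finite B \<and> A1 \<union> A2 \<subseteq> B"
    then show "coef ((f1 \<oplus>\<^bsub>S\<^esub> f2) \<otimes>\<^bsub>S\<^esub> g) k =
      (\<Oplus>i\<in>B. coef (f1 \<oplus>\<^bsub>S\<^esub> f2) i \<otimes> (coef g (k - i) \<otimes> p [^] xy_exp i (k - i)))"
      by (intro *) auto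
  qed
qed

text \<open>Isolates one term of the convolution modulo an ideal. The zero ideal gives exact extreme
  coefficients; a component of a homogeneous ideal gives the primality test.\<close>

lemma coef_mult_modulo:
  assumes "f \<in> carrier S" "g \<in> carrier S" and I: "ideal I R"
    and rest: "\<And>i. i \<noteq> m \<Longrightarrow>
      coef f i \<otimes> (coef g (m + n - i) \<otimes> p [^] xy_exp i (m + n - i)) \<in> I"
  shows "\<exists>x\<in>I. coef (f \<otimes>\<^bsub>S\<^esub> g) (m + n) = coef f m \<otimes> (coef g n \<otimes> p [^] xy_exp m n) \<oplus> x"
proof -
  interpret I: ideal I R by (rule I)
  let ?h = "\<lambda>i. coef f i \<otimes> (coef g (m + n - i) \<otimes> p [^] xy_exp i (m + n - i))"
  obtain A where A: "finite A" "\<And>B. finite B \<Longrightarrow> A \<subseteq> B \<Longrightarrow> coef (f \<otimes>\<^bsub>S\<^esub> g) (m + n) = finsum R ?h B"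
    using coef_mult[OF assms(1,2)] by metis
  have "finsum R ?h B \<in> I" if "finite B" "m \<notin> B" for B
    using that
  proof (induction B)
    case (insert i B)
    then show ?case using rest[of i] assms(1,2) by (subst finsum_insert) auto
  qed simp
  then have "finsum R ?h (A - {m}) \<in> I" using A by simp
  \<comment> \<open>A need not contain m, but every finite set that includes A may serve as index
    set.\<close>
  moreover have "coef (f \<otimes>\<^bsub>S\<^esub> g) (m + n) = finsum R ?h (insert m (A - {m}))"
    using A by (intro A(2)) auto
  then have "coef (f \<otimes>\<^bsub>S\<^esub> g) (m + n) = ?h m \<oplus> finsum R ?h (A - {m})"
    using assms(1,2) A(1) by (subst (asm) finsum_insert) auto
  ultimately show ?thesis by (auto simp: add_diff_cancel_left')
qed

lemma coef_mult_single:
  assumes "f \<in> carrier S" "g \<in> carrier S"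
    and "\<And>i. i \<noteq> m \<Longrightarrow> coef f i = \<zero> \<or> coef g (m + n - i) = \<zero>"
  shows "coef (f \<otimes>\<^bsub>S\<^esub> g) (m + n) = coef f m \<otimes> (coef g n \<otimes> p [^] xy_exp m n)"
proof -
  have "coef f i \<otimes> (coef g (m + n - i) \<otimes> p [^] xy_exp i (m + n - i)) \<in> {\<zero>}"
    if "i \<noteq> m" for i
    using assms(3)[OF that] assms(1,2) by auto
  from coef_mult_modulo[OF assms(1,2) zeroideal this] show ?thesis
    using assms(1,2) by auto
qed

text \<open>Compare the highest coefficients of \<open>f\<close> and \<open>g\<close> lying outside \<open>J\<close>.\<close>

lemma homogeneous_prime:
  assumes J: "\<And>n. ideal (J n) R"
    and stable: "\<And>a m n. a \<in> J m \<Longrightarrow> a \<otimes> p [^] xy_exp m n \<in> J (m + n)"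
    and prime: "\<And>a b m n. \<lbrakk>a \<in> carrier R; b \<in> carrier R; a \<otimes> (b \<otimes> p [^] xy_exp m n) \<in> J (m + n)\<rbrakk>
      \<Longrightarrow> a \<in> J m \<or> b \<in> J n"
    and f: "f \<in> carrier S" and g: "g \<in> carrier S"
    and fg: "\<And>n. coef (f \<otimes>\<^bsub>S\<^esub> g) n \<in> J n"
  shows "(\<forall>n. coef f n \<in> J n) \<or> (\<forall>n. coef g n \<in> J n)"
proof (rule ccontr)
  assume contr: "\<not> ?thesis"
  have zero: "\<zero> \<in> J n" for n
    using additive_subgroup.zero_closed[OF ideal.axioms(1)[OF J]] .
  have top: "\<exists>m. coef h m \<notin> J m \<and> (\<forall>i>m. coef h i \<in> J i)"
    if h: "h \<in> carrier S" "\<exists>n. coef h n \<notin> J n" for h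
  proof -
    let ?A = "{n. coef h n \<notin> J n}"
    have A: "finite ?A" "?A \<noteq> {}"
      using h zero by (auto intro: finite_subset[OF _ finite_support[OF h(1)]])
    show ?thesis
      using Max_in[OF A] Max_ge[OF A(1)] by (intro exI[of _ "Max ?A"]) (auto simp: not_less[symmetric])
  qed
  obtain m where m: "coef f m \<notin> J m" "\<And>i. i > m \<Longrightarrow> coef f i \<in> J i" using top[of f] f contr by blast
  obtain n where n: "coef g n \<notin> J n" "\<And>i. i > n \<Longrightarrow> coef g i \<in> J i" using top[of g] g contr by blast
  interpret I: ideal "J (m + n)" R by (rule J)
  \<comment> \<open>In every other term either the degree in f exceeds m or the degree in g exceeds
    n. That factor lies in its component of J, and \<open>stable\<close> carries it to degree m + n
    together with the power of p.\<close>
  have rest: "coef f i \<otimes> (coef g (m + n - i) \<otimes> p [^] xy_exp i (m + n - i)) \<in> J (m + n)"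
    if "i \<noteq> m" for i
  proof (cases "i > m")
    case True
    then have "coef f i \<otimes> p [^] xy_exp i (m + n - i) \<in> J (m + n)"
      using stable[OF m(2), of i "m + n - i"] by simp
    then have "coef g (m + n - i) \<otimes> (coef f i \<otimes> p [^] xy_exp i (m + n - i)) \<in> J (m + n)"
      using g by (rule I.I_l_closed[OF _ coef_closed])
    then show ?thesis using f g by (simp add: m_lcomm)
  next
    case False
    then have "coef g (m + n - i) \<otimes> p [^] xy_exp (m + n - i) i \<in> J (m + n)"
      using stable[OF n(2), of "m + n - i" i] that by simp
    then show ?thesis using f by (simp add: xy_exp_commute I.I_l_closed)
  qed
  obtain x where x: "x \<in> J (m + n)"
      "coef (f \<otimes>\<^bsub>S\<^esub> g) (m + n) = coef f m \<otimes> (coef g n \<otimes> p [^] xy_exp m n) \<oplus> x"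
    using coef_mult_modulo[OF f g J rest] by blast
  have "y = (y \<oplus> x) \<ominus> x" if "y \<in> carrier R" for y
    using that I.Icarr[OF x(1)] by algebra
  then have "coef f m \<otimes> (coef g n \<otimes> p [^] xy_exp m n) = coef (f \<otimes>\<^bsub>S\<^esub> g) (m + n) \<ominus> x"
    unfolding x(2) using f g by simp
  then have "coef f m \<otimes> (coef g n \<otimes> p [^] xy_exp m n) \<in> J (m + n)"
    using fg[of "m + n"] x(1) unfolding a_minus_def by auto
  then show False using prime f g m(1) n(1) by (meson coef_closed)
qed

sublocale S: "domain" S
proof (rule domainI[OF S.cring_axioms])
  show "\<one>\<^bsub>S\<^esub> \<noteq> \<zero>\<^bsub>S\<^esub>"
    using coef_one[of 0] coef_zero[of 0] one_not_zero by auto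
next
  fix f g assume fg: "f \<otimes>\<^bsub>S\<^esub> g = \<zero>\<^bsub>S\<^esub>" "f \<in> carrier S" "g \<in> carrier S"
  \<comment> \<open>The zero ideal is homogeneous with all components {0}; it passes the test
    because R is a domain and powers of p are nonzero.\<close>
  have "(\<forall>n. coef f n \<in> {\<zero>}) \<or> (\<forall>n. coef g n \<in> {\<zero>})"
    using fg
    by (intro homogeneous_prime zeroideal) (auto simp: coef_zero integral_iff p_pow_nonzero)
  then show "f = \<zero>\<^bsub>S\<^esub> \<or> g = \<zero>\<^bsub>S\<^esub>" using fg coef_eq_zero by auto
qed

section \<open>Divisibility by homogeneous elements; primality of s, t and of primes of R\<close>

lemma divides_if_divides_components:
  assumes x: "x \<in> carrier S" and f: "f \<in> carrier S"
    and "\<And>n. x divides\<^bsub>S\<^esub> emb (coef f n) \<otimes>\<^bsub>S\<^esub> u n"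
  shows "x divides\<^bsub>S\<^esub> f"
proof -
  have "\<And>f. \<lbrakk>f \<in> carrier S; {n. coef f n \<noteq> \<zero>} \<subseteq> A;
      \<And>n. x divides\<^bsub>S\<^esub> emb (coef f n) \<otimes>\<^bsub>S\<^esub> u n\<rbrakk> \<Longrightarrow> x divides\<^bsub>S\<^esub> f" if "finite A" for A
    using that
  proof (induction A)
    case empty
    then have "f = \<zero>\<^bsub>S\<^esub>" by (intro coef_eq_zero) auto
    then show ?case using x S.divides_zero by simp
  next
    case (insert m A)
    let ?h = "emb (coef f m) \<otimes>\<^bsub>S\<^esub> u m"
    let ?g = "f \<ominus>\<^bsub>S\<^esub> ?h"
    have coef: "coef ?g n = (if n = m then \<zero> else coef f n)" for n
      using insert.prems(1) by (simp add: coef_minus coef_monom) (simp add: a_minus_def)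
    have "x divides\<^bsub>S\<^esub> ?g"
    proof (rule insert.IH)
      show "?g \<in> carrier S" using insert.prems(1) by simp
      show "{n. coef ?g n \<noteq> \<zero>} \<subseteq> A" using insert.prems(2) by (auto simp: coef)
      show "x divides\<^bsub>S\<^esub> emb (coef ?g n) \<otimes>\<^bsub>S\<^esub> u n" for n
        using insert.prems(3)[of n] S.divides_zero[OF x] by (simp add: coef)
    qed
    then have "x divides\<^bsub>S\<^esub> (?g \<oplus>\<^bsub>S\<^esub> ?h)" by (intro S.divides_add x insert.prems(3))
    moreover have "?g \<oplus>\<^bsub>S\<^esub> ?h = f"
    proof -
      have "?h \<in> carrier S" using insert.prems(1) by simp
      with insert.prems(1) show ?thesis by algebra
    qed
    ultimately show ?case by simp
  qed
  then show ?thesis using finite_support[OF f] assms by blast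
qed

text \<open>Here J n consists of the coefficients in degree n of the multiples of x. By
  \<open>divides_iff\<close> the ideal generated by x is homogeneous, so
  \<open>homogeneous_prime\<close> decides whether it is prime.\<close>

lemma ring_prime_of_homogeneous:
  assumes x: "x \<in> carrier S" "x \<noteq> \<zero>\<^bsub>S\<^esub>"
    and divides_iff: "\<And>f. f \<in> carrier S \<Longrightarrow> x divides\<^bsub>S\<^esub> f \<longleftrightarrow> (\<forall>n. coef f n \<in> J n)"
    and J: "\<And>n. ideal (J n) R"
    and stable: "\<And>a m n. a \<in> J m \<Longrightarrow> a \<otimes> p [^] xy_exp m n \<in> J (m + n)"
    and prime: "\<And>a b m n. \<lbrakk>a \<in> carrier R; b \<in> carrier R; a \<otimes> (b \<otimes> p [^] xy_exp m n) \<in> J (m + n)\<rbrakk>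
      \<Longrightarrow> a \<in> J m \<or> b \<in> J n"
    and proper: "\<one> \<notin> J 0"
  shows "ring_prime\<^bsub>S\<^esub> x"
proof (rule S.ring_primeI[OF x(2)], rule primeI)
  have "\<not> x divides\<^bsub>S\<^esub> \<one>\<^bsub>S\<^esub>" using divides_iff[of "\<one>\<^bsub>S\<^esub>"] proper by (auto simp: coef_one)
  then show "x \<notin> Units S" using S.divides_one[OF x(1)] by simp
next
  fix f g assume fg: "f \<in> carrier S" "g \<in> carrier S" "x divides\<^bsub>S\<^esub> f \<otimes>\<^bsub>S\<^esub> g"
  then have *: "coef (f \<otimes>\<^bsub>S\<^esub> g) n \<in> J n" for n using divides_iff[of "f \<otimes>\<^bsub>S\<^esub> g"] by simp
  show "x divides\<^bsub>S\<^esub> f \<or> x divides\<^bsub>S\<^esub> g"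
    using homogeneous_prime[of J f g, OF J stable prime fg(1,2) *] divides_iff fg by simp
qed

lemma emb_divides_iff:
  assumes q: "q \<in> carrier R" and f: "f \<in> carrier S"
  shows "emb q divides\<^bsub>S\<^esub> f \<longleftrightarrow> (\<forall>n. q divides coef f n)"
proof
  assume "emb q divides\<^bsub>S\<^esub> f"
  then obtain g where g: "g \<in> carrier S" "f = emb q \<otimes>\<^bsub>S\<^esub> g" by blast
  then have "coef f n = q \<otimes> coef g n" for n
    using coef_monom_mult[of q g 0 n] q by (simp add: u_0)
  then show "\<forall>n. q divides coef f n" using g coef_closed dividesI by blast
next
  assume *: "\<forall>n. q divides coef f n"
  show "emb q divides\<^bsub>S\<^esub> f"
  proof (rule divides_if_divides_components)
    fix n
    obtain b where "b \<in> carrier R" "coef f n = q \<otimes> b" using * by blast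
    then show "emb q divides\<^bsub>S\<^esub> emb (coef f n) \<otimes>\<^bsub>S\<^esub> u n"
      using q by (intro dividesI[of "emb b \<otimes>\<^bsub>S\<^esub> u n"]) (simp_all add: emb.hom_mult S.m_assoc)
  qed (use q f in auto)
qed

text \<open>Multiplication by s sends u (n - 1) to u n when n > 0, but for n <= 0 it consumes one
  factor t and yields p u n.\<close>

lemma s_divides_iff:
  assumes f: "f \<in> carrier S"
  shows "s divides\<^bsub>S\<^esub> f \<longleftrightarrow> (\<forall>n\<le>0. p divides coef f n)"
proof
  assume "s divides\<^bsub>S\<^esub> f"
  then obtain g where g: "g \<in> carrier S" "f = s \<otimes>\<^bsub>S\<^esub> g" by blast
  have "coef f n = p \<otimes> coef g (n - 1)" if "n \<le> 0" for n
  proof -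
    have "xy_exp 1 (n - 1) = 1" using that by (simp add: xy_exp_def)
    then show ?thesis
      using coef_monom_mult[of \<one> g 1 n] g by (simp add: u_1 m_comm)
  qed
  then show "\<forall>n\<le>0. p divides coef f n" using g coef_closed dividesI by blast
next
  assume *: "\<forall>n\<le>0. p divides coef f n"
  show "s divides\<^bsub>S\<^esub> f"
  proof (rule divides_if_divides_components)
    fix n :: int
    show "s divides\<^bsub>S\<^esub> emb (coef f n) \<otimes>\<^bsub>S\<^esub> u n"
    proof (cases "n \<le> 0")
      case True
      then obtain b where "b \<in> carrier R" "coef f n = p \<otimes> b" using * by blast
      then show ?thesis
        by (intro dividesI[of "t \<otimes>\<^bsub>S\<^esub> (emb b \<otimes>\<^bsub>S\<^esub> u n)"])
          (simp_all add: emb.hom_mult S.m_assoc s_mult_t[symmetric])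
    next
      case False
      then have "u n = s \<otimes>\<^bsub>S\<^esub> u (n - 1)"
        using u_mult[of 1 "n - 1"] by (simp add: xy_exp_same_sign u_1)
      then show ?thesis using f
        by (intro dividesI[of "emb (coef f n) \<otimes>\<^bsub>S\<^esub> u (n - 1)"]) (simp_all add: S.m_lcomm)
    qed
  qed (use f in auto)
qed

lemma s_not_divides_t:
  assumes "ring_prime p" shows "\<not> s divides\<^bsub>S\<^esub> t"
proof
  assume "s divides\<^bsub>S\<^esub> t"
  then have "p divides coef t (- 1)" by (simp add: s_divides_iff)
  also have "coef t (- 1) = \<one>" using coef_monom[of \<one> "- 1" "- 1"] by (simp add: u_minus_1)
  finally show False using assms divides_one[OF p_closed] unfolding ring_prime_def prime_def by blast
qed

lemma emb_eq_zero: "a \<in> carrier R \<Longrightarrow> emb a = \<zero>\<^bsub>S\<^esub> \<Longrightarrow> a = \<zero>"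
  using coef_monom[of a 0 0] by (simp add: u_0 coef_zero)

text \<open>All components of the ideal equal q R. The extra power of p in products of monomials is
  harmless, since q divides no power of p.\<close>

lemma emb_prime:
  assumes p: "ring_prime p" and q: "q \<in> carrier R" "ring_prime q" "\<not> q \<sim> p"
  shows "ring_prime\<^bsub>S\<^esub> (emb q)"
proof (rule ring_prime_of_homogeneous[where J = "\<lambda>_. {x \<in> carrier R. q divides x}"])
  have qp: "\<not> q divides p" using prime_divides_prime_imp_associated p q by auto
  have q1: "\<not> q divides \<one>" using q divides_one unfolding ring_prime_def prime_def by simp
  have pow: "\<not> q divides p [^] (k::nat)" for k
  proof (induction k)
    case (Suc k)
    then show ?case
      using qp ring_prime_divides_mult[OF q(2), of "p [^] k" p] by auto
  qed (simp add: q1)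
  show "a \<in> {x \<in> carrier R. q divides x} \<or> b \<in> {x \<in> carrier R. q divides x}"
    if "a \<in> carrier R" "b \<in> carrier R" "a \<otimes> (b \<otimes> p [^] xy_exp m n) \<in> {x \<in> carrier R. q divides x}"
    for a b m n
    using that pow ring_prime_divides_mult[OF q(2), of a "b \<otimes> p [^] xy_exp m n"]
      ring_prime_divides_mult[OF q(2), of b "p [^] xy_exp m n"] by auto
  show "\<one> \<notin> {x \<in> carrier R. q divides x}" using q1 by simp
  show "emb q \<noteq> \<zero>\<^bsub>S\<^esub>" using emb_eq_zero q by (auto simp: ring_prime_def)
  show "ideal {x \<in> carrier R. q divides x} R" by (rule multiples_ideal[OF q(1)])
  show "emb q divides\<^bsub>S\<^esub> f \<longleftrightarrow> (\<forall>n. coef f n \<in> {x \<in> carrier R. q divides x})"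
    if "f \<in> carrier S" for f
    using that q(1) by (simp add: emb_divides_iff)
  show "a \<otimes> p [^] xy_exp m n \<in> {x \<in> carrier R. q divides x}"
    if "a \<in> {x \<in> carrier R. q divides x}" for a m n
    using that q(1) by (simp add: divides_prod_r)
qed (use q(1) in simp)

text \<open>The components of the ideal are p R in degrees n <= 0 and R in degrees n > 0. Primality
  has content only for two degrees <= 0, where the product of monomials carries no power of p.
  Passing from a degree m > 0 to m + n <= 0 always produces a factor p, whence stability.\<close>

lemma s_prime:
  assumes p: "ring_prime p" shows "ring_prime\<^bsub>S\<^esub> s"
proof (rule ring_prime_of_homogeneous[where J = "\<lambda>n. {x \<in> carrier R. n \<le> 0 \<longrightarrow> p divides x}"])
  show "ideal {x \<in> carrier R. n \<le> 0 \<longrightarrow> p divides x} R" for n :: int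
    using multiples_ideal[of p] oneideal by (cases "n \<le> 0") auto
  show "\<one> \<notin> {x \<in> carrier R. (0::int) \<le> 0 \<longrightarrow> p divides x}"
    using p divides_one unfolding ring_prime_def prime_def by simp
  show "s \<noteq> \<zero>\<^bsub>S\<^esub>"
    using emb_eq_zero[of p] s_mult_t p_nonzero by auto
  show "a \<otimes> p [^] xy_exp m n \<in> {x \<in> carrier R. m + n \<le> 0 \<longrightarrow> p divides x}"
    if a: "a \<in> {x \<in> carrier R. m \<le> 0 \<longrightarrow> p divides x}" for a m n
  proof (cases "m \<le> 0")
    case True
    then show ?thesis using a by (auto simp: divides_prod_r)
  next
    case False
    have "p divides p [^] xy_exp m n" if "m + n \<le> 0"
    proof -
      have "xy_exp m n \<noteq> 0" using False that by (simp add: xy_exp_def)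
      then obtain k where "xy_exp m n = Suc k" using not0_implies_Suc by blast
      then show ?thesis by (intro dividesI[of "p [^] k"]) (simp_all add: m_comm)
    qed
    then show ?thesis using a by (auto simp: divides_prod_l)
  qed
  show "a \<in> {x \<in> carrier R. m \<le> 0 \<longrightarrow> p divides x} \<or> b \<in> {x \<in> carrier R. n \<le> 0 \<longrightarrow> p divides x}"
    if ab: "a \<in> carrier R" "b \<in> carrier R"
      "a \<otimes> (b \<otimes> p [^] xy_exp m n) \<in> {x \<in> carrier R. m + n \<le> 0 \<longrightarrow> p divides x}" for a b m n
  proof (cases "m \<le> 0 \<and> n \<le> 0")
    case True
    then show ?thesis using ab ring_prime_divides_mult[OF p, of a b]
      by (auto simp: xy_exp_same_sign)
  qed (use ab in auto)
  show "s divides\<^bsub>S\<^esub> f \<longleftrightarrow> (\<forall>n. coef f n \<in> {x \<in> carrier R. n \<le> 0 \<longrightarrow> p divides x})"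
    if "f \<in> carrier S" for f
    using that by (simp add: s_divides_iff)
qed simp

text \<open>Exchanging s and t reverses the degrees and preserves all axioms, so facts about s carry
  over to t.\<close>

lemma swap: "adjunction R S emb p t s (\<lambda>f n. coef f (- n))"
proof -
  have u': "t [^]\<^bsub>S\<^esub> nat n \<otimes>\<^bsub>S\<^esub> s [^]\<^bsub>S\<^esub> nat (- n) = u (- n)" for n
    by (simp add: u_def S.m_comm)
  show ?thesis
  proof (unfold_locales, unfold u')
    fix f :: 'c and P
    assume *: "f \<in> carrier S" "\<And>a n. a \<in> carrier R \<Longrightarrow> P (emb a \<otimes>\<^bsub>S\<^esub> u (- n))"
      "\<And>f g. \<lbrakk>f \<in> carrier S; g \<in> carrier S; P f; P g\<rbrakk> \<Longrightarrow> P (f \<oplus>\<^bsub>S\<^esub> g)"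
    show "P f"
      using *(1)
    proof (induction rule: monom_induct)
      case (monom a n)
      then show ?case using *(2)[of a "- n"] by simp
    qed (rule *(3))
  next
    fix f assume "f \<in> carrier S" "\<And>n. coef f (- n) = \<zero>"
    moreover from this(2)[of "- n" for n] have "coef f n = \<zero>" for n by simp
    ultimately show "f = \<zero>\<^bsub>S\<^esub>" by (intro coef_eq_zero)
  next
    show "t \<otimes>\<^bsub>S\<^esub> s = emb p" by (simp add: S.m_comm s_mult_t)
  qed (simp_all add: emb_hom p_nonzero coef_add coef_monom)
qed

lemma t_prime:
  assumes "ring_prime p" shows "ring_prime\<^bsub>S\<^esub> t"
  using adjunction.s_prime[OF swap assms] .

end

section \<open>Weights and pseudo-division\<close>

locale factorial_adjunction = adjunction R S emb p s t u coef + factorial_domain R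
  for R (structure) and S (structure) and emb p s t u coef +
  assumes p_prime: "ring_prime p"
begin

abbreviation count_factors :: "'a \<Rightarrow> nat" where
  "count_factors \<equiv> factorcount (mult_of R)"

text \<open>
  A prime of \<open>R\<close> gets weight \<open>2\<close>, since \<open>p\<close> becomes the product of \<open>s\<close> and \<open>t\<close>.
\<close>

definition weight :: "'a \<Rightarrow> int \<Rightarrow> nat" where
  "weight a n = 2 * count_factors a + nat \<bar>n\<bar>"

lemma count_factors_p_pow: "count_factors (p [^] (k::nat)) = k"
proof (induction k)
  case 0
  show ?case using factorcount_Units[of \<one>] by simp
next
  case (Suc k)
  have "irreducible (mult_of R) p"
    using mult_of.prime_irreducible ring_primeE[OF p_closed p_prime] p_closed by auto
  then have "count_factors p = 1"
    using factorcount_irreducible[of p] p_nonzero by simp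
  then show ?case
    using Suc factorcount_mult[of "p [^] k" p] p_pow_nonzero p_nonzero by simp
qed

text \<open>The power of p contributes \<open>2 * xy_exp m n\<close>, exactly what the absolute
  degrees lose by cancellation.\<close>

lemma weight_mult:
  assumes "a \<in> carrier R - {\<zero>}" "b \<in> carrier R - {\<zero>}"
  shows "weight (a \<otimes> (b \<otimes> p [^] xy_exp m n)) (m + n) = weight a m + weight b n"
proof -
  have "count_factors (a \<otimes> (b \<otimes> p [^] xy_exp m n)) = count_factors a + (count_factors b + xy_exp m n)"
    using assms factorcount_mult[of a "b \<otimes> p [^] xy_exp m n"]
      factorcount_mult[of b "p [^] xy_exp m n"]
    by (simp add: count_factors_p_pow p_pow_nonzero integral_iff)
  then show ?thesis using two_xy_exp[of m n] by (simp add: weight_def)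
qed

lemma weight_eq_0_imp: "a \<in> carrier R - {\<zero>} \<Longrightarrow> weight a n = 0 \<Longrightarrow> a \<in> Units R \<and> n = 0"
  using factorcount_eq_0_imp_Units[of a] by (simp add: weight_def)

section \<open>Highest and lowest terms, the additive weight, and the units\<close>

definition hi :: "'c \<Rightarrow> int" where "hi f = Max {n. coef f n \<noteq> \<zero>}"
definition lo :: "'c \<Rightarrow> int" where "lo f = Min {n. coef f n \<noteq> \<zero>}"

lemma hi_lo:
  assumes "f \<in> carrier S - {\<zero>\<^bsub>S\<^esub>}"
  shows coef_hi: "coef f (hi f) \<in> carrier R - {\<zero>}" and coef_lo: "coef f (lo f) \<in> carrier R - {\<zero>}"
    and hi_bound: "coef f n \<noteq> \<zero> \<Longrightarrow> n \<le> hi f" and lo_bound: "coef f n \<noteq> \<zero> \<Longrightarrow> lo f \<le> n"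
proof -
  have *: "finite {n. coef f n \<noteq> \<zero>}" "{n. coef f n \<noteq> \<zero>} \<noteq> {}"
    using assms finite_support coef_eq_zero by auto
  show "coef f (hi f) \<in> carrier R - {\<zero>}" "coef f (lo f) \<in> carrier R - {\<zero>}"
    using Max_in[OF *] Min_in[OF *] assms by (auto simp: hi_def lo_def)
  show "coef f n \<noteq> \<zero> \<Longrightarrow> n \<le> hi f" "coef f n \<noteq> \<zero> \<Longrightarrow> lo f \<le> n"
    using * by (auto simp: hi_def lo_def)
qed

lemma lo_le_hi: "f \<in> carrier S - {\<zero>\<^bsub>S\<^esub>} \<Longrightarrow> lo f \<le> hi f"
  using lo_bound[of f "hi f"] coef_hi[of f] by auto

lemma hi_eqI:
  assumes "f \<in> carrier S - {\<zero>\<^bsub>S\<^esub>}" "coef f m \<noteq> \<zero>" "\<And>n. n > m \<Longrightarrow> coef f n = \<zero>"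
  shows "hi f = m"
proof (rule ccontr)
  assume "hi f \<noteq> m"
  then have "hi f > m" using hi_bound[OF assms(1,2)] by simp
  then show False using assms(3)[of "hi f"] coef_hi[OF assms(1)] by simp
qed

lemma lo_eqI:
  assumes "f \<in> carrier S - {\<zero>\<^bsub>S\<^esub>}" "coef f m \<noteq> \<zero>" "\<And>n. n < m \<Longrightarrow> coef f n = \<zero>"
  shows "lo f = m"
proof (rule ccontr)
  assume "lo f \<noteq> m"
  then have "lo f < m" using lo_bound[OF assms(1,2)] by simp
  then show False using assms(3)[of "lo f"] coef_lo[OF assms(1)] by simp
qed

context
  fixes f g assumes f: "f \<in> carrier S - {\<zero>\<^bsub>S\<^esub>}" and g: "g \<in> carrier S - {\<zero>\<^bsub>S\<^esub>}"
begin

lemma mult_nonzero: "f \<otimes>\<^bsub>S\<^esub> g \<in> carrier S - {\<zero>\<^bsub>S\<^esub>}"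
  using f g S.integral_iff by auto

lemma coef_mult_hi:
  "coef (f \<otimes>\<^bsub>S\<^esub> g) (hi f + hi g) = coef f (hi f) \<otimes> (coef g (hi g) \<otimes> p [^] xy_exp (hi f) (hi g))"
proof (rule coef_mult_single)
  show "coef f i = \<zero> \<or> coef g (hi f + hi g - i) = \<zero>" if "i \<noteq> hi f" for i
    using that hi_bound[OF f, of i] hi_bound[OF g, of "hi f + hi g - i"] by fastforce
qed (use f g in auto)

lemma coef_mult_lo:
  "coef (f \<otimes>\<^bsub>S\<^esub> g) (lo f + lo g) = coef f (lo f) \<otimes> (coef g (lo g) \<otimes> p [^] xy_exp (lo f) (lo g))"
proof (rule coef_mult_single)
  show "coef f i = \<zero> \<or> coef g (lo f + lo g - i) = \<zero>" if "i \<noteq> lo f" for i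
    using that lo_bound[OF f, of i] lo_bound[OF g, of "lo f + lo g - i"] by fastforce
qed (use f g in auto)

lemma hi_mult: "hi (f \<otimes>\<^bsub>S\<^esub> g) = hi f + hi g"
proof (rule hi_eqI[OF mult_nonzero])
  show "coef (f \<otimes>\<^bsub>S\<^esub> g) (hi f + hi g) \<noteq> \<zero>"
    using coef_hi[OF f] coef_hi[OF g] by (simp add: coef_mult_hi integral_iff p_pow_nonzero)
next
  fix n assume n: "n > hi f + hi g"
  \<comment> \<open>Above the sum of the highest degrees every term has a zero factor. The split of
    n is chosen so that the one term left by \<open>coef_mult_single\<close> visibly vanishes
    too.\<close>
  have "coef (f \<otimes>\<^bsub>S\<^esub> g) ((n - hi g) + hi g) =
      coef f (n - hi g) \<otimes> (coef g (hi g) \<otimes> p [^] xy_exp (n - hi g) (hi g))"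
    using f g n hi_bound[OF f] hi_bound[OF g] by (intro coef_mult_single) force+
  moreover have "coef f (n - hi g) = \<zero>" using hi_bound[OF f, of "n - hi g"] n by force
  ultimately show "coef (f \<otimes>\<^bsub>S\<^esub> g) n = \<zero>" using g by simp
qed

lemma lo_mult: "lo (f \<otimes>\<^bsub>S\<^esub> g) = lo f + lo g"
proof (rule lo_eqI[OF mult_nonzero])
  show "coef (f \<otimes>\<^bsub>S\<^esub> g) (lo f + lo g) \<noteq> \<zero>"
    using coef_lo[OF f] coef_lo[OF g] by (simp add: coef_mult_lo integral_iff p_pow_nonzero)
next
  fix n assume n: "n < lo f + lo g"
  have "coef (f \<otimes>\<^bsub>S\<^esub> g) ((n - lo g) + lo g) =
      coef f (n - lo g) \<otimes> (coef g (lo g) \<otimes> p [^] xy_exp (n - lo g) (lo g))"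
    using f g n lo_bound[OF f] lo_bound[OF g] by (intro coef_mult_single) force+
  moreover have "coef f (n - lo g) = \<zero>" using lo_bound[OF f, of "n - lo g"] n by force
  ultimately show "coef (f \<otimes>\<^bsub>S\<^esub> g) n = \<zero>" using g by simp
qed

end

text \<open>Both ends are needed: 1 + t has highest term 1 and 1 + s has lowest term 1, and neither
  is a unit.\<close>

definition total_weight :: "'c \<Rightarrow> nat" where
  "total_weight f = weight (coef f (hi f)) (hi f) + weight (coef f (lo f)) (lo f)"

lemma total_weight_mult:
  assumes f: "f \<in> carrier S - {\<zero>\<^bsub>S\<^esub>}" and g: "g \<in> carrier S - {\<zero>\<^bsub>S\<^esub>}"
  shows "total_weight (f \<otimes>\<^bsub>S\<^esub> g) = total_weight f + total_weight g"
  unfolding total_weight_def hi_mult[OF f g] lo_mult[OF f g] coef_mult_hi[OF f g] coef_mult_lo[OF f g]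
    weight_mult[OF coef_hi[OF f] coef_hi[OF g]] weight_mult[OF coef_lo[OF f] coef_lo[OF g]]
  by simp

lemma emb_Units:
  assumes "a \<in> Units R" shows "emb a \<in> Units S"
proof -
  have "emb a \<otimes>\<^bsub>S\<^esub> emb (inv a) = \<one>\<^bsub>S\<^esub>"
    using assms emb.hom_mult[of a "inv a"] by (simp add: Units_closed)
  then have "emb a divides\<^bsub>S\<^esub> \<one>\<^bsub>S\<^esub>"
    using assms by (intro dividesI[of "emb (inv a)"]) auto
  then show ?thesis using S.divides_one emb.hom_closed[OF Units_closed[OF assms]] by blast
qed

lemma total_weight_eq_0_imp:
  assumes f: "f \<in> carrier S - {\<zero>\<^bsub>S\<^esub>}" and "total_weight f = 0"
  shows "f \<in> emb ` Units R"
proof -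
  have *: "coef f (hi f) \<in> Units R" "hi f = 0" "lo f = 0"
    using weight_eq_0_imp[OF coef_hi[OF f]] weight_eq_0_imp[OF coef_lo[OF f]] assms(2)
    by (auto simp: total_weight_def)
  then have "coef f k = \<zero>" if "k \<noteq> 0" for k
    using hi_bound[OF f, of k] lo_bound[OF f, of k] that by force
  then have "f = emb (coef f 0) \<otimes>\<^bsub>S\<^esub> u 0" using f by (intro eq_monomI) auto
  then have "f = emb (coef f 0)" using f by (simp add: u_0)
  then show ?thesis using * by auto
qed

text \<open>An additive function with natural values vanishes at 1, hence at every unit, and weight
  0 leaves only units of R.\<close>

lemma Units_eq: "Units S = emb ` Units R"
proof (intro equalityI subsetI)
  fix f assume f: "f \<in> Units S"
  have nz: "g \<in> carrier S - {\<zero>\<^bsub>S\<^esub>}" if "g \<in> Units S" for g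
    using S.prime_products_closed[OF prime_products.unit[OF that]] .
  have one: "\<one>\<^bsub>S\<^esub> \<in> carrier S - {\<zero>\<^bsub>S\<^esub>}" using nz[of "\<one>\<^bsub>S\<^esub>"] by simp
  have "total_weight \<one>\<^bsub>S\<^esub> = 0" using total_weight_mult[OF one one] by simp
  moreover have "total_weight (f \<otimes>\<^bsub>S\<^esub> inv\<^bsub>S\<^esub> f) = total_weight f + total_weight (inv\<^bsub>S\<^esub> f)"
    using f by (intro total_weight_mult nz) auto
  ultimately have "total_weight f = 0" using f by simp
  then show "f \<in> emb ` Units R" by (intro total_weight_eq_0_imp nz f)
qed (use emb_Units in auto)

text \<open>Factor a in R: primes associated with p become a unit times s t, the others stay prime
  by \<open>emb_prime\<close>. The monomial u n is a product of powers of s and t.\<close>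

lemma monom_in_prime_products:
  assumes "a \<in> carrier R - {\<zero>}" shows "emb a \<otimes>\<^bsub>S\<^esub> u n \<in> prime_products S"
proof -
  have s: "s \<in> prime_products S" and t: "t \<in> prime_products S"
    by (simp_all add: S.prime_in_prime_products s_prime[OF p_prime] t_prime[OF p_prime])
  have "a \<in> prime_products R" using assms prime_products_eq by simp
  then have "emb a \<in> prime_products S"
  proof (induction rule: prime_products.induct)
    case (unit v)
    then show ?case by (intro prime_products.unit emb_Units)
  next
    case (mult q c)
    have "emb q \<in> prime_products S"
    proof (cases "q \<sim> p")
      case True
      then obtain v where v: "v \<in> Units R" "q = v \<otimes> p"
        using ring_associated_iff[of q p] mult.hyps by auto
      then have "emb q = emb v \<otimes>\<^bsub>S\<^esub> (s \<otimes>\<^bsub>S\<^esub> t)"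
        by (simp add: emb.hom_mult s_mult_t Units_closed)
      then show ?thesis
        using s t v by (simp add: S.prime_products_mult prime_products.unit emb_Units)
    next
      case False
      then show ?thesis
        using mult.hyps by (intro S.prime_in_prime_products emb_prime p_prime) auto
    qed
    then show ?case
      using mult prime_products_closed[OF mult.hyps(3)]
      by (simp add: emb.hom_mult S.prime_products_mult)
  qed
  then show ?thesis
    unfolding u_def by (intro S.prime_products_mult S.prime_products_pow s t)
qed

section \<open>Pseudo-division with respect to the width of the support\<close>

definition width :: "'c \<Rightarrow> nat" where "width f = nat (hi f - lo f)"

text \<open>Each of f and d is multiplied by the highest term of the other, so the terms in degree
  hi f + hi d cancel. The hypothesis on widths says hi d + lo f <= hi f + lo d, so nothing appears
  below hi d + lo f.\<close>

lemma pseudo_division_step: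
  assumes f: "f \<in> carrier S - {\<zero>\<^bsub>S\<^esub>}" and d: "d \<in> carrier S - {\<zero>\<^bsub>S\<^esub>}" and "width d \<le> width f"
  defines "f' \<equiv> (emb (coef d (hi d)) \<otimes>\<^bsub>S\<^esub> u (hi d)) \<otimes>\<^bsub>S\<^esub> f \<ominus>\<^bsub>S\<^esub> (emb (coef f (hi f)) \<otimes>\<^bsub>S\<^esub> u (hi f)) \<otimes>\<^bsub>S\<^esub> d"
  shows "f' = \<zero>\<^bsub>S\<^esub> \<or> width f' < width f"
proof (rule disjCI)
  assume nz: "\<not> width f' < width f"
  have c: "f' \<in> carrier S" using f d by (simp add: f'_def)
  have coef: "coef f' k = coef d (hi d) \<otimes> (coef f (k - hi d) \<otimes> p [^] xy_exp (hi d) (k - hi d))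
      \<ominus> coef f (hi f) \<otimes> (coef d (k - hi f) \<otimes> p [^] xy_exp (hi f) (k - hi f))" for k
    using f d by (simp add: f'_def coef_minus coef_monom_mult)
  have zero: "coef f' k = \<zero>" if k: "k < hi d + lo f \<or> hi d + hi f \<le> k" for k
  proof (cases "k = hi d + hi f")
    case True
    then show ?thesis using f d by (simp add: coef xy_exp_commute m_lcomm a_minus_def r_neg)
  next
    case False
    have "coef f (k - hi d) = \<zero>" using k False lo_bound[OF f, of "k - hi d"] hi_bound[OF f, of "k - hi d"] by force
    moreover have "coef d (k - hi f) = \<zero>"
      using k False lo_bound[OF d, of "k - hi f"] hi_bound[OF d, of "k - hi f"] assms(3) lo_le_hi[OF f] lo_le_hi[OF d]
      by (force simp: width_def)
    ultimately show ?thesis using f d by (simp add: coef)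
  qed
  show "f' = \<zero>\<^bsub>S\<^esub>"
  proof (rule ccontr)
    assume "f' \<noteq> \<zero>\<^bsub>S\<^esub>"
    then have f': "f' \<in> carrier S - {\<zero>\<^bsub>S\<^esub>}" using c by simp
    have "hi f' < hi d + hi f" "hi d + lo f \<le> lo f'"
      using zero[of "hi f'"] zero[of "lo f'"] coef_hi[OF f'] coef_lo[OF f'] by force+
    then show False using nz lo_le_hi[OF f'] by (simp add: width_def)
  qed
qed

text \<open>Each round multiplies f by the highest term of d, which is homogeneous and hence in
  \<open>prime_products\<close>. For homogeneous d the width is 0, so the remainder is zero.\<close>

lemma pseudo_division:
  assumes "f \<in> carrier S - {\<zero>\<^bsub>S\<^esub>}" "d \<in> carrier S - {\<zero>\<^bsub>S\<^esub>}"
  shows "\<exists>c q r. c \<in> prime_products S \<and> q \<in> carrier S \<and> r \<in> carrier S \<and>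
    c \<otimes>\<^bsub>S\<^esub> f = q \<otimes>\<^bsub>S\<^esub> d \<oplus>\<^bsub>S\<^esub> r \<and> (r = \<zero>\<^bsub>S\<^esub> \<or> width r < width d)"
  using assms(1)
proof (induction "width f" arbitrary: f rule: less_induct)
  case less
  have one: "\<one>\<^bsub>S\<^esub> \<in> prime_products S" by (simp add: prime_products.unit)
  show ?case
  proof (cases "width f < width d")
    case True
    then show ?thesis using less.prems assms(2) one
      by (intro exI[of _ "\<one>\<^bsub>S\<^esub>"] exI[of _ "\<zero>\<^bsub>S\<^esub>"] exI[of _ f]) auto
  next
    case False
    define a b where "a = emb (coef d (hi d)) \<otimes>\<^bsub>S\<^esub> u (hi d)" and "b = emb (coef f (hi f)) \<otimes>\<^bsub>S\<^esub> u (hi f)"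
    define f' where "f' = a \<otimes>\<^bsub>S\<^esub> f \<ominus>\<^bsub>S\<^esub> b \<otimes>\<^bsub>S\<^esub> d"
    have a: "a \<in> prime_products S" using coef_hi[OF assms(2)] by (simp add: a_def monom_in_prime_products)
    have ac: "a \<in> carrier S" and bc: "b \<in> carrier S" using less.prems assms(2) by (auto simp: a_def b_def)
    have fc: "f \<in> carrier S" and dc: "d \<in> carrier S" using less.prems assms(2) by auto
    have f'c: "f' \<in> carrier S" using ac bc fc dc by (simp add: f'_def)
    have af: "a \<otimes>\<^bsub>S\<^esub> f = b \<otimes>\<^bsub>S\<^esub> d \<oplus>\<^bsub>S\<^esub> f'"
    proof -
      have "x = y \<oplus>\<^bsub>S\<^esub> (x \<ominus>\<^bsub>S\<^esub> y)" if "x \<in> carrier S" "y \<in> carrier S" for x y using that by algebra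
      then show ?thesis unfolding f'_def using ac bc fc dc by simp
    qed
    have less_width: "f' = \<zero>\<^bsub>S\<^esub> \<or> width f' < width f"
      unfolding f'_def a_def b_def using False by (intro pseudo_division_step less.prems assms(2)) simp
    show ?thesis
    proof (cases "f' = \<zero>\<^bsub>S\<^esub>")
      case True
      then show ?thesis
        using a ac bc fc dc af by (intro exI[of _ a] exI[of _ b] exI[of _ "\<zero>\<^bsub>S\<^esub>"]) auto
    next
      case False
      then have lt: "width f' < width f" using less_width by blast
      obtain c q r where IH: "c \<in> prime_products S" "q \<in> carrier S" "r \<in> carrier S"
          "c \<otimes>\<^bsub>S\<^esub> f' = q \<otimes>\<^bsub>S\<^esub> d \<oplus>\<^bsub>S\<^esub> r" "r = \<zero>\<^bsub>S\<^esub> \<or> width r < width d"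
        using less.hyps[OF lt] f'c False by blast
      have cc: "c \<in> carrier S" using S.prime_products_closed[OF IH(1)] by simp
      have "(c \<otimes>\<^bsub>S\<^esub> a) \<otimes>\<^bsub>S\<^esub> f = c \<otimes>\<^bsub>S\<^esub> (b \<otimes>\<^bsub>S\<^esub> d) \<oplus>\<^bsub>S\<^esub> c \<otimes>\<^bsub>S\<^esub> f'"
        using cc ac bc fc dc f'c by (simp add: S.m_assoc af S.r_distr)
      also have "\<dots> = (c \<otimes>\<^bsub>S\<^esub> b \<oplus>\<^bsub>S\<^esub> q) \<otimes>\<^bsub>S\<^esub> d \<oplus>\<^bsub>S\<^esub> r"
        unfolding IH(4) using cc bc dc IH(2,3) by (simp add: S.m_assoc S.l_distr S.a_assoc)
      finally show ?thesis
        using S.prime_products_mult[OF IH(1) a] cc bc IH(2,3,5)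
        by (intro exI[of _ "c \<otimes>\<^bsub>S\<^esub> a"] exI[of _ "c \<otimes>\<^bsub>S\<^esub> b \<oplus>\<^bsub>S\<^esub> q"] exI[of _ r]) auto
    qed
  qed
qed

lemma factorial_domain_S: "factorial_domain S"
proof (rule S.factorial_domain_of_pseudo_division[where \<phi> = width and N = total_weight])
  show "f \<in> Units S" if "f \<in> carrier S - {\<zero>\<^bsub>S\<^esub>}" "total_weight f = 0" for f
    using total_weight_eq_0_imp[OF that] Units_eq by simp
qed (use pseudo_division total_weight_mult in auto)

end

section \<open>Normal forms in \<open>R[x, y]/(xy - p)\<close>\<close>

locale adj_setting = "domain" R for R (structure) +
  fixes p assumes p_closed: "p \<in> carrier R" and p_nonzero: "p \<noteq> \<zero>"
begin

sublocale P: UP_domain R "UP R" by unfold_locales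
sublocale Q: UP_domain "UP R" "UP2 R"
  using UP2_domain by (simp add: UP_domain_def)
sublocale A: cring "adj_ring R p" by (rule adj_ring_cring[OF p_closed])

definition u :: "int \<Rightarrow> (nat \<Rightarrow> nat \<Rightarrow> 'a) set" where
  "u n = adj_s R p [^]\<^bsub>adj_ring R p\<^esub> nat n \<otimes>\<^bsub>adj_ring R p\<^esub> adj_s' R p [^]\<^bsub>adj_ring R p\<^esub> nat (- n)"

lemma generators:
  "adjunction_generators R (adj_ring R p) (adj_emb R p) p (adj_s R p) (adj_s' R p)"
  by unfold_locales
    (simp_all add: adj_emb_hom adj_closed adj_s_mult_adj_s' p_closed p_nonzero)

sublocale G: adjunction_generators R "adj_ring R p" "adj_emb R p" p "adj_s R p" "adj_s' R p" u
  by (rule generators) (simp add: u_def)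

definition cls :: "(nat \<Rightarrow> nat \<Rightarrow> 'a) \<Rightarrow> (nat \<Rightarrow> nat \<Rightarrow> 'a) set" where
  "cls F = xy_ideal R p +>\<^bsub>UP2 R\<^esub> F"

sublocale cls: ring_hom_cring "UP2 R" "adj_ring R p" cls
proof (rule UnivPoly.ring_hom_cringI)
  have "cls = (+>\<^bsub>UP2 R\<^esub>) (xy_ideal R p)" by (simp add: cls_def fun_eq_iff)
  then show "cls \<in> ring_hom (UP2 R) (adj_ring R p)"
    using ideal.rcos_ring_hom[OF xy_ideal[OF p_closed]] by (simp add: adj_ring_def)
qed (use UP2_domain A.is_cring in \<open>auto simp: domain_def\<close>)

lemma cls_generators:
  "cls (var_x R) = adj_s R p" "cls (var_y R) = adj_s' R p" "cls (const2 R a) = adj_emb R p a"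
  by (simp_all add: cls_def adj_s_def adj_s'_def adj_emb_def)

lemma cls_surj: "f \<in> carrier (adj_ring R p) \<Longrightarrow> \<exists>F\<in>carrier (UP2 R). f = cls F"
  by (auto simp: adj_ring_def FactRing_def A_RCOSETS_def' cls_def)

lemma cls_eq_zero: "F \<in> carrier (UP2 R) \<Longrightarrow> cls F = \<zero>\<^bsub>adj_ring R p\<^esub> \<Longrightarrow> F \<in> xy_ideal R p"
proof -
  interpret I: ideal "xy_ideal R p" "UP2 R" by (rule xy_ideal[OF p_closed])
  assume "F \<in> carrier (UP2 R)" "cls F = \<zero>\<^bsub>adj_ring R p\<^esub>"
  then show ?thesis using I.a_rcos_self[of F] by (simp add: cls_def adj_ring_def FactRing_def)
qed

section \<open>The monomials u n span the quotient\<close>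

definition bimonom :: "'a \<Rightarrow> nat \<Rightarrow> nat \<Rightarrow> nat \<Rightarrow> nat \<Rightarrow> 'a" where
  "bimonom a i j = monom (UP2 R) (monom (UP R) a i) j"

lemma bimonom_closed: "a \<in> carrier R \<Longrightarrow> bimonom a i j \<in> carrier (UP2 R)"
  by (simp add: bimonom_def)

lemma bimonom_mult:
  assumes "a \<in> carrier R" "b \<in> carrier R"
  shows "bimonom a i j \<otimes>\<^bsub>UP2 R\<^esub> bimonom b k l = bimonom (a \<otimes> b) (i + k) (j + l)"
  using assms by (simp add: bimonom_def del: P.monom_mult Q.monom_mult add: P.monom_mult[symmetric] Q.monom_mult[symmetric])

lemma cls_bimonom:
  assumes "a \<in> carrier R"
  shows "cls (bimonom a i j) = adj_emb R p a \<otimes>\<^bsub>adj_ring R p\<^esub>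
    (adj_s R p [^]\<^bsub>adj_ring R p\<^esub> i \<otimes>\<^bsub>adj_ring R p\<^esub> adj_s' R p [^]\<^bsub>adj_ring R p\<^esub> j)"
proof -
  have x: "cls (bimonom \<one> i 0) = adj_s R p [^]\<^bsub>adj_ring R p\<^esub> i" for i
  proof (induction i)
    case 0
    have "bimonom \<one> 0 0 = \<one>\<^bsub>UP2 R\<^esub>" by (simp add: bimonom_def)
    then show ?case by simp
  next
    case (Suc i)
    have "bimonom \<one> (Suc i) 0 = bimonom \<one> i 0 \<otimes>\<^bsub>UP2 R\<^esub> var_x R"
      using bimonom_mult[of \<one> \<one> i 0 1 0] by (simp add: var_x_def bimonom_def)
    then show ?case using Suc by (simp add: cls_generators bimonom_closed var_closed)
  qed
  have y: "cls (bimonom \<one> 0 j) = adj_s' R p [^]\<^bsub>adj_ring R p\<^esub> j" for j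
  proof (induction j)
    case 0
    have "bimonom \<one> 0 0 = \<one>\<^bsub>UP2 R\<^esub>" by (simp add: bimonom_def)
    then show ?case by simp
  next
    case (Suc j)
    have "bimonom \<one> 0 (Suc j) = bimonom \<one> 0 j \<otimes>\<^bsub>UP2 R\<^esub> var_y R"
      using bimonom_mult[of \<one> \<one> 0 j 0 1] by (simp add: var_y_def bimonom_def)
    then show ?case using Suc by (simp add: cls_generators bimonom_closed var_closed)
  qed
  have "bimonom a i j = const2 R a \<otimes>\<^bsub>UP2 R\<^esub> (bimonom \<one> i 0 \<otimes>\<^bsub>UP2 R\<^esub> bimonom \<one> 0 j)"
  proof -
    have "const2 R a = bimonom a 0 0" by (simp add: const2_def bimonom_def)
    then show ?thesis using assms by (simp add: bimonom_mult)
  qed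
  then show ?thesis
    using assms by (simp add: x y cls_generators bimonom_closed var_closed)
qed

text \<open>Expand F in powers of y and each coefficient in powers of x; the empty sum is a
  bimonomial with coefficient zero.\<close>

lemma UP2_induct [consumes 1, case_names bimonom add]:
  assumes F: "F \<in> carrier (UP2 R)"
    and bimonom: "\<And>a i j. a \<in> carrier R \<Longrightarrow> P (bimonom a i j)"
    and add: "\<And>F G. \<lbrakk>F \<in> carrier (UP2 R); G \<in> carrier (UP2 R); P F; P G\<rbrakk> \<Longrightarrow> P (F \<oplus>\<^bsub>UP2 R\<^esub> G)"
  shows "P F"
proof -
  have zero: "P \<zero>\<^bsub>UP2 R\<^esub>" using bimonom[of \<zero> 0 0] by (simp add: bimonom_def)
  have sum: "P (finsum (UP2 R) h A)" if "finite A" "\<And>i. i \<in> A \<Longrightarrow> h i \<in> carrier (UP2 R) \<and> P (h i)"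
    for h :: "nat \<Rightarrow> _" and A
    using that
  proof (induction A)
    case (insert i A)
    have "finsum (UP2 R) h (insert i A) = h i \<oplus>\<^bsub>UP2 R\<^esub> finsum (UP2 R) h A"
      using insert by (intro Q.P.finsum_insert) auto
    then show ?case using insert by (auto intro!: add Q.P.finsum_closed)
  qed (simp add: zero)
  have coeff: "P (monom (UP2 R) c j)" if c: "c \<in> carrier (UP R)" for c j
  proof -
    have "P (monom (UP2 R) (finsum (UP R) (\<lambda>i. monom (UP R) (coeff (UP R) c i) i) A) j)"
      if "finite A" for A
      using that
    proof (induction A)
      case (insert i A)
      have "finsum (UP R) (\<lambda>i. monom (UP R) (coeff (UP R) c i) i) (insert i A) =
          monom (UP R) (coeff (UP R) c i) i \<oplus>\<^bsub>UP R\<^esub> finsum (UP R) (\<lambda>i. monom (UP R) (coeff (UP R) c i) i) A"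
        using insert c by (intro P.P.finsum_insert) auto
      then show ?case
        using insert c bimonom[of "coeff (UP R) c i" i j] by (simp add: add bimonom_def)
    qed (simp add: zero)
    from this[of "{..deg R c}"] show ?thesis using P.up_repr[OF c] by simp
  qed
  have "P (finsum (UP2 R) (\<lambda>i. monom (UP2 R) (coeff (UP2 R) F i) i) {..deg (UP R) F})"
    using F by (intro sum) (auto intro: coeff)
  then show ?thesis using Q.up_repr[OF F] by simp
qed

text \<open>The class of x^i y^j is p^k u (i - j) with k = min i j, so all bimonomials reduce to
  multiples of the u n.\<close>

lemma adj_ring_induct [consumes 1, case_names monom add]:
  assumes f: "f \<in> carrier (adj_ring R p)"
    and monom: "\<And>a n. a \<in> carrier R \<Longrightarrow> P (adj_emb R p a \<otimes>\<^bsub>adj_ring R p\<^esub> u n)"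
    and add: "\<And>f g. \<lbrakk>f \<in> carrier (adj_ring R p); g \<in> carrier (adj_ring R p); P f; P g\<rbrakk>
      \<Longrightarrow> P (f \<oplus>\<^bsub>adj_ring R p\<^esub> g)"
  shows "P f"
proof -
  obtain F where F: "F \<in> carrier (UP2 R)" "f = cls F" using cls_surj[OF f] by blast
  have "P (cls F)" using F(1)
  proof (induction rule: UP2_induct)
    case (bimonom a i j)
    have "cls (bimonom a i j) = adj_emb R p (a \<otimes> p [^] min i j) \<otimes>\<^bsub>adj_ring R p\<^esub> u (int i - int j)"
      using bimonom p_closed by (simp add: cls_bimonom G.s_pow_mult_t_pow G.emb.hom_mult A.m_assoc)
    then show ?case using monom bimonom p_closed by simp
  qed (simp add: add)
  then show ?thesis using F by simp
qed

text \<open>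
  Normal forms modulo \<open>xy - p\<close>: the polynomials without monomials divisible by \<open>xy\<close>.
\<close>

definition NF :: "(nat \<Rightarrow> nat \<Rightarrow> 'a) set" where
  "NF = {F \<in> carrier (UP2 R). \<forall>j>0. \<exists>b\<in>carrier R. coeff (UP2 R) F j = monom (UP R) b 0}"

lemma NF_closed: "F \<in> NF \<Longrightarrow> F \<in> carrier (UP2 R)"
  by (simp add: NF_def)

lemma NF_add: assumes "F \<in> NF" "G \<in> NF" shows "F \<oplus>\<^bsub>UP2 R\<^esub> G \<in> NF"
proof -
  have "\<exists>b\<in>carrier R. coeff (UP2 R) (F \<oplus>\<^bsub>UP2 R\<^esub> G) j = monom (UP R) b 0" if j: "j > 0" for j
  proof -
    obtain b c where "b \<in> carrier R" "c \<in> carrier R" "coeff (UP2 R) F j = monom (UP R) b 0"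
        "coeff (UP2 R) G j = monom (UP R) c 0"
      using assms j unfolding NF_def by blast
    then show ?thesis using assms by (intro bexI[of _ "b \<oplus> c"]) (simp_all add: NF_closed)
  qed
  then show ?thesis using assms by (simp add: NF_def)
qed

lemma NF_minus: assumes "F \<in> NF" "G \<in> NF" shows "F \<ominus>\<^bsub>UP2 R\<^esub> G \<in> NF"
proof -
  have "\<exists>b\<in>carrier R. coeff (UP2 R) (F \<ominus>\<^bsub>UP2 R\<^esub> G) j = monom (UP R) b 0" if j: "j > 0" for j
  proof -
    obtain b c where "b \<in> carrier R" "c \<in> carrier R" "coeff (UP2 R) F j = monom (UP R) b 0"
        "coeff (UP2 R) G j = monom (UP R) c 0"
      using assms j unfolding NF_def by blast
    then show ?thesis using assms by (intro bexI[of _ "b \<ominus> c"]) (simp_all add: NF_closed a_minus_def)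
  qed
  then show ?thesis using assms by (simp add: NF_def)
qed

text \<open>
  In a multiple of \<open>xy - p\<close> the leading coefficient with respect to \<open>y\<close> is a multiple of \<open>x\<close>.
\<close>

lemma NF_Int_xy_ideal:
  assumes G: "G \<in> NF" "G \<in> xy_ideal R p" shows "G = \<zero>\<^bsub>UP2 R\<^esub>"
proof -
  let ?x = "monom (UP R) \<one> 1"
  obtain F where F: "F \<in> carrier (UP2 R)"
      "G = F \<otimes>\<^bsub>UP2 R\<^esub> (var_x R \<otimes>\<^bsub>UP2 R\<^esub> var_y R \<ominus>\<^bsub>UP2 R\<^esub> const2 R p)"
    using G(2) by (auto simp: xy_ideal_def cgenideal_def)
  let ?c = "monom (UP R) p 0"
  have c: "?c \<in> carrier (UP R)" "?x \<in> carrier (UP R)" using p_closed by auto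
  have xy: "var_x R \<otimes>\<^bsub>UP2 R\<^esub> var_y R = monom (UP2 R) ?x 1"
    using Q.monom_mult[of ?x "\<one>\<^bsub>UP R\<^esub>" 0 1] by (simp add: var_x_def var_y_def)
  have G_eq: "G = monom (UP2 R) ?x 1 \<otimes>\<^bsub>UP2 R\<^esub> F \<ominus>\<^bsub>UP2 R\<^esub> monom (UP2 R) ?c 0 \<otimes>\<^bsub>UP2 R\<^esub> F"
  proof -
    have "x \<in> carrier (UP2 R) \<Longrightarrow> y \<in> carrier (UP2 R) \<Longrightarrow>
        F \<otimes>\<^bsub>UP2 R\<^esub> (x \<ominus>\<^bsub>UP2 R\<^esub> y) = x \<otimes>\<^bsub>UP2 R\<^esub> F \<ominus>\<^bsub>UP2 R\<^esub> y \<otimes>\<^bsub>UP2 R\<^esub> F" for x y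
      using F(1) by algebra
    then show ?thesis unfolding F(2) xy const2_def using c by simp
  qed
  show ?thesis
  proof (cases "F = \<zero>\<^bsub>UP2 R\<^esub>")
    case True
    then show ?thesis using c unfolding G_eq by simp
  next
    case False
    \<comment> \<open>Multiplication by x y moves the leading coefficient c of F in y to degree d +
      1, where p F contributes nothing. So G has coefficient x c there, and d + 1 > 0 brings in the
      normal form condition.\<close>
    define d where "d = deg (UP R) F"
    have lc: "coeff (UP2 R) F d \<noteq> \<zero>\<^bsub>UP R\<^esub>" "coeff (UP2 R) F d \<in> carrier (UP R)"
      using Q.lcoeff_nonzero[OF False F(1)] F(1) by (auto simp: d_def)
    have "coeff (UP2 R) F (Suc d) = \<zero>\<^bsub>UP R\<^esub>"
      using F(1) by (intro Q.deg_aboveD) (auto simp: d_def)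
    then have "coeff (UP2 R) (monom (UP2 R) ?c 0 \<otimes>\<^bsub>UP2 R\<^esub> F) (Suc d) = \<zero>\<^bsub>UP R\<^esub>"
      using Q.coeff_monom_mult[OF c(1) F(1), of 0 "Suc d"] c by (simp del: Q.coeff_mult)
    moreover have "coeff (UP2 R) (monom (UP2 R) ?x 1 \<otimes>\<^bsub>UP2 R\<^esub> F) (Suc d) = ?x \<otimes>\<^bsub>UP R\<^esub> coeff (UP2 R) F d"
      using Q.coeff_monom_mult[OF c(2) F(1), of 1 d] by (simp del: Q.coeff_mult)
    ultimately have "coeff (UP2 R) G (Suc d) = ?x \<otimes>\<^bsub>UP R\<^esub> coeff (UP2 R) F d"
      unfolding G_eq using c F(1) lc by (simp add: a_minus_def del: Q.coeff_mult)
    moreover obtain b where b: "b \<in> carrier R" "coeff (UP2 R) G (Suc d) = monom (UP R) b 0"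
      using G(1) by (auto simp: NF_def)
    ultimately have "?x \<otimes>\<^bsub>UP R\<^esub> coeff (UP2 R) F d = monom (UP R) b 0" by simp
    \<comment> \<open>x c has positive degree in x, whereas a normal form has constant coefficients
      at positive powers of y.\<close>
    then have "deg R (?x \<otimes>\<^bsub>UP R\<^esub> coeff (UP2 R) F d) = 0" using P.deg_const[OF b(1)] by (simp only:)
    moreover have "coeff (UP R) ?x 1 = \<one>" by (rule trans[OF P.coeff_monom]) simp_all
    then have "?x \<noteq> \<zero>\<^bsub>UP R\<^esub>" using P.coeff_zero[of 1] one_not_zero by metis
    ultimately show ?thesis using lc P.deg_mult[OF _ lc(1) c(2) lc(2)] by simp
  qed
qed

section \<open>Coordinates read off from normal forms\<close>

definition NF_coef :: "(nat \<Rightarrow> nat \<Rightarrow> 'a) \<Rightarrow> int \<Rightarrow> 'a" where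
  "NF_coef F n = (if 0 \<le> n then coeff (UP R) (coeff (UP2 R) F 0) (nat n)
    else coeff (UP R) (coeff (UP2 R) F (nat (- n))) 0)"

lemma NF_coef_closed: "F \<in> NF \<Longrightarrow> NF_coef F n \<in> carrier R"
  by (simp add: NF_coef_def NF_closed)

lemma NF_coef_add:
  "\<lbrakk>F \<in> NF; G \<in> NF\<rbrakk> \<Longrightarrow> NF_coef (F \<oplus>\<^bsub>UP2 R\<^esub> G) n = NF_coef F n \<oplus> NF_coef G n"
  by (simp add: NF_coef_def NF_closed)

lemma NF_coef_eq_zero:
  assumes F: "F \<in> NF" and zero: "\<And>n. NF_coef F n = \<zero>" shows "F = \<zero>\<^bsub>UP2 R\<^esub>"
proof (rule Q.up_eqI)
  fix j
  show "coeff (UP2 R) F j = coeff (UP2 R) \<zero>\<^bsub>UP2 R\<^esub> j"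
  proof (cases "j = 0")
    case True
    have "coeff (UP2 R) F 0 = \<zero>\<^bsub>UP R\<^esub>"
    proof (rule P.up_eqI)
      fix i show "coeff (UP R) (coeff (UP2 R) F 0) i = coeff (UP R) \<zero>\<^bsub>UP R\<^esub> i"
        using zero[of "int i"] by (simp add: NF_coef_def)
    qed (use F in \<open>auto simp: NF_closed\<close>)
    then show ?thesis using True by simp
  next
    case False
    then obtain b where b: "b \<in> carrier R" "coeff (UP2 R) F j = monom (UP R) b 0"
      using F by (auto simp: NF_def)
    have "b = \<zero>" using zero[of "- int j"] False b by (simp add: NF_coef_def)
    then show ?thesis using b by simp
  qed
qed (use F in \<open>auto simp: NF_closed\<close>)

lemma bimonom_NF:
  assumes "a \<in> carrier R" shows "bimonom a (nat n) (nat (- n)) \<in> NF"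
proof -
  have "\<exists>b\<in>carrier R. coeff (UP2 R) (bimonom a (nat n) (nat (- n))) k = monom (UP R) b 0" if "k > 0" for k
    using assms that
    by (cases "k = nat (- n)") (auto simp: bimonom_def intro: bexI[of _ a] bexI[of _ \<zero>])
  then show ?thesis using assms by (simp add: NF_def bimonom_closed)
qed

lemma NF_coef_bimonom:
  assumes "a \<in> carrier R"
  shows "NF_coef (bimonom a (nat m) (nat (- m))) n = (if n = m then a else \<zero>)"
  using assms by (auto simp: NF_coef_def bimonom_def)

text \<open>The difference of two normal forms is a normal form, and zero is the only one in the
  ideal.\<close>

lemma cls_inj_NF:
  assumes "F \<in> NF" "G \<in> NF" "cls F = cls G" shows "F = G"
proof -
  have "cls (F \<ominus>\<^bsub>UP2 R\<^esub> G) = \<zero>\<^bsub>adj_ring R p\<^esub>"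
    using assms by (simp add: NF_closed a_minus_def A.r_neg)
  then have "F \<ominus>\<^bsub>UP2 R\<^esub> G \<in> xy_ideal R p" using assms by (intro cls_eq_zero) (simp_all add: NF_closed)
  then have "F \<ominus>\<^bsub>UP2 R\<^esub> G = \<zero>\<^bsub>UP2 R\<^esub>" using assms NF_Int_xy_ideal NF_minus by blast
  then show ?thesis using assms by (simp add: NF_closed)
qed

lemma cls_bimonom_u:
  assumes "a \<in> carrier R"
  shows "cls (bimonom a (nat m) (nat (- m))) = adj_emb R p a \<otimes>\<^bsub>adj_ring R p\<^esub> u m"
  using assms by (simp add: cls_bimonom u_def)

text \<open>No reduction procedure is required: multiples of the u n have evident normal forms, and
  normal forms are closed under addition.\<close>

lemma ex_NF: "f \<in> carrier (adj_ring R p) \<Longrightarrow> \<exists>F\<in>NF. cls F = f"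
proof (induction f rule: adj_ring_induct)
  case (monom a n)
  then show ?case by (intro bexI[of _ "bimonom a (nat n) (nat (- n))"]) (auto simp: cls_bimonom_u bimonom_NF)
next
  case (add f g)
  then obtain F G where "F \<in> NF" "G \<in> NF" "cls F = f" "cls G = g" by blast
  then show ?case by (intro bexI[of _ "F \<oplus>\<^bsub>UP2 R\<^esub> G"]) (auto simp: NF_closed NF_add)
qed

text \<open>The choice made by \<open>inv_into\<close> is harmless: each class contains exactly one
  normal form.\<close>

definition coef :: "(nat \<Rightarrow> nat \<Rightarrow> 'a) set \<Rightarrow> int \<Rightarrow> 'a" where
  "coef f = NF_coef (inv_into NF cls f)"

lemma coef_cls: "F \<in> NF \<Longrightarrow> coef (cls F) = NF_coef F"
  using inv_into_f_f[of cls NF F] cls_inj_NF by (simp add: coef_def inj_on_def)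

sublocale adjunction R "adj_ring R p" "adj_emb R p" p "adj_s R p" "adj_s' R p" u coef
proof (unfold_locales, unfold u_def[symmetric])
  fix f n assume "f \<in> carrier (adj_ring R p)"
  then obtain F where "F \<in> NF" "cls F = f" using ex_NF by blast
  then show "coef f n \<in> carrier R" using coef_cls[of F] by (simp add: NF_coef_closed)
next
  fix f g n assume "f \<in> carrier (adj_ring R p)" "g \<in> carrier (adj_ring R p)"
  then obtain F G where FG: "F \<in> NF" "cls F = f" "G \<in> NF" "cls G = g" using ex_NF by metis
  then have "cls (F \<oplus>\<^bsub>UP2 R\<^esub> G) = f \<oplus>\<^bsub>adj_ring R p\<^esub> g" by (simp add: NF_closed)
  then show "coef (f \<oplus>\<^bsub>adj_ring R p\<^esub> g) n = coef f n \<oplus> coef g n"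
    using FG coef_cls[of "F \<oplus>\<^bsub>UP2 R\<^esub> G"] coef_cls[of F] coef_cls[of G] by (simp add: NF_add NF_coef_add)
next
  fix a m n assume "a \<in> carrier R"
  then show "coef (adj_emb R p a \<otimes>\<^bsub>adj_ring R p\<^esub> u m) n = (if n = m then a else \<zero>)"
    using coef_cls[OF bimonom_NF[of a m]]
    by (auto simp: cls_bimonom_u NF_coef_bimonom)
next
  fix f assume f: "f \<in> carrier (adj_ring R p)" "\<And>n. coef f n = \<zero>"
  obtain F where F: "F \<in> NF" "cls F = f" using ex_NF[OF f(1)] by blast
  then have "F = \<zero>\<^bsub>UP2 R\<^esub>" using f(2) coef_cls[of F] by (intro NF_coef_eq_zero) auto
  then show "f = \<zero>\<^bsub>adj_ring R p\<^esub>" using F by simp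
next
  fix f P assume "f \<in> carrier (adj_ring R p)"
    "\<And>a n. a \<in> carrier R \<Longrightarrow> P (adj_emb R p a \<otimes>\<^bsub>adj_ring R p\<^esub> u n)"
    "\<And>f g. \<lbrakk>f \<in> carrier (adj_ring R p); g \<in> carrier (adj_ring R p); P f; P g\<rbrakk>
      \<Longrightarrow> P (f \<oplus>\<^bsub>adj_ring R p\<^esub> g)"
  then show "P f" by (rule adj_ring_induct)
qed

end

section \<open>The four assertions for the quotient ring\<close>

theorem lemma2p4:
  fixes R :: "('a, 'm) ring_scheme" and p :: 'a
  assumes "factorial_domain R"
    and "p \<in> carrier R" and "ring_prime\<^bsub>R\<^esub> p"
  shows "(ring_prime\<^bsub>adj_ring R p\<^esub> (adj_s R p) \<and>
          ring_prime\<^bsub>adj_ring R p\<^esub> (adj_s' R p) \<and>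
          \<not> adj_s R p \<sim>\<^bsub>adj_ring R p\<^esub> adj_s' R p) \<and>
         (\<forall>q\<in>carrier R. ring_prime\<^bsub>R\<^esub> q \<and> \<not> q \<sim>\<^bsub>R\<^esub> p \<longrightarrow>
            ring_prime\<^bsub>adj_ring R p\<^esub> (adj_emb R p q)) \<and>
         (Units (adj_ring R p) = adj_emb R p ` Units R \<and>
          (\<forall>r\<in>carrier R. {a \<in> carrier (adj_ring R p). a \<sim>\<^bsub>adj_ring R p\<^esub> adj_emb R p r} =
             adj_emb R p ` {b \<in> carrier R. b \<sim>\<^bsub>R\<^esub> r})) \<and>
         factorial_domain (adj_ring R p)"
proof -
  interpret R: factorial_domain R by fact
  interpret adj_setting R p
    using assms by unfold_locales (auto simp: ring_prime_def)
  interpret F: factorial_adjunction R "adj_ring R p" "adj_emb R p" p "adj_s R p" "adj_s' R p" u coef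
    by unfold_locales (fact assms(3))
  have "{a \<in> carrier (adj_ring R p). a \<sim>\<^bsub>adj_ring R p\<^esub> adj_emb R p r} =
      adj_emb R p ` {b \<in> carrier R. b \<sim>\<^bsub>R\<^esub> r}" if r: "r \<in> carrier R" for r
  proof -
    \<comment> \<open>Associates are unit multiples and the units correspond by
      \<open>F.Units_eq\<close>, so in both rings they are the v r with v a unit of R.\<close>
    have S: "a \<sim>\<^bsub>adj_ring R p\<^esub> adj_emb R p r \<longleftrightarrow> (\<exists>v\<in>Units R. a = adj_emb R p (v \<otimes>\<^bsub>R\<^esub> r))"
      if "a \<in> carrier (adj_ring R p)" for a
      using that r S.ring_associated_iff[of a "adj_emb R p r"]
      by (auto simp: F.Units_eq G.emb.hom_mult R.Units_closed)
    have R: "b \<sim>\<^bsub>R\<^esub> r \<longleftrightarrow> (\<exists>v\<in>Units R. b = v \<otimes>\<^bsub>R\<^esub> r)" if "b \<in> carrier R" for b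
      using that r by (rule R.ring_associated_iff)
    show ?thesis
    proof (intro equalityI subsetI)
      fix a assume "a \<in> {a \<in> carrier (adj_ring R p). a \<sim>\<^bsub>adj_ring R p\<^esub> adj_emb R p r}"
      then obtain v where v: "v \<in> Units R" "a = adj_emb R p (v \<otimes>\<^bsub>R\<^esub> r)" using S by blast
      then have "v \<otimes>\<^bsub>R\<^esub> r \<in> {b \<in> carrier R. b \<sim>\<^bsub>R\<^esub> r}" 
        using R[of "v \<otimes>\<^bsub>R\<^esub> r"] r R.Units_closed[of v] by auto
      then show "a \<in> adj_emb R p ` {b \<in> carrier R. b \<sim>\<^bsub>R\<^esub> r}" using v by blast
    next
      fix a assume "a \<in> adj_emb R p ` {b \<in> carrier R. b \<sim>\<^bsub>R\<^esub> r}"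
      then obtain b where b: "b \<in> carrier R" "b \<sim>\<^bsub>R\<^esub> r" "a = adj_emb R p b" by blast
      then show "a \<in> {a \<in> carrier (adj_ring R p). a \<sim>\<^bsub>adj_ring R p\<^esub> adj_emb R p r}"
        using S[of a] R by auto
    qed
  qed
  \<comment> \<open>If they were associated, s would divide s', whose coefficient 1 in degree -1 is
    not a multiple of p.\<close>
  moreover have "\<not> adj_s R p \<sim>\<^bsub>adj_ring R p\<^esub> adj_s' R p"
    using s_not_divides_t[OF assms(3)] by (auto simp: associated_def)
  ultimately show ?thesis
    using s_prime[OF assms(3)] t_prime[OF assms(3)] emb_prime[OF assms(3)] F.Units_eq F.factorial_domain_S
    by blast
qed

end
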